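(* Let $\mathfrak p\subset A=\mathbb F_q[T]$ be a nonzero prime ideal, $d=\deg_T(\mathfrak p)$, and let $\phi$ be a supersingular Drinfeld module of rank $r\ge2$ over $\overline{\mathbb F}_{\mathfrak p}$, where $\mathbb F_{\mathfrak p}=A/\mathfrak p$. Let $\mathfrak q_1,\dots,\mathfrak q_\ell\in A$ be distinct monic irreducible polynomials of degree $m$, different from $\mathfrak p$; let $1\le t\le\ell r$ be an integer, $s=tm-1$, with $tm-1\ge\frac{r^2(r-1)(d-1)}2$. Let $\lambda\in\mathbb Z_{\ge0}$ satisfy $\lambda+s<m\ell r$, and set $$\varepsilon_\lambda=\min\left\{\left\lfloor\frac{\dim_{\mathbb F_q}M_\lambda(\phi)-1}{mr}\right\rfloor,\ \left\lfloor\frac{m(\ell r-t)-\lambda}{m}\right\rfloor\right\}.$$ Then the filter decoder (the algorithm described in the context) with filter-degree bound $\lambda$ and decoding radius $\varepsilon=\varepsilon_\lambda$ corrects every error tuple of sum-rank weight at most $\varepsilon_\lambda$: for every $u\in M_s(\phi)$ and every $(E_1,\dots,E_\ell)\in\operatorname{Mat}_{r\times r}(\mathbb F_{q^m})^\ell$ with $\sum_i\operatorname{rk}_{\mathbb F_{q^m}}(E_i)\le\varepsilon_\lambda$, on input $Y_i=\rho_i(u)+E_i$ ($i=1,\dots,\ell$) it returns $u$. In characteristic $\mathfrak p=(T)$, taking $\lambda=m\left\lfloor\frac{\ell r-t}{2}\right\rfloor$ gives $\varepsilon_\lambda=\left\lfloor\frac{\ell r-t}{2}\right\rfloor$; thus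 in this case the filter decoder reaches the full unique-decoding radius.
   Context: $q$ is a prime power, $A=\mathbb F_q[T]$. The same symbol is used for a nonzero ideal of $A$ and its monic generator. The field $k=\overline{\mathbb F}_{\mathfrak p}$ is an $A$-field via $\gamma:A\to A/\mathfrak p\hookrightarrow k$. The twisted polynomial (Ore) ring $k\{\tau\}$ consists of polynomials $\sum a_i\tau^i$ with $(a\tau^i)(b\tau^j)=ab^{q^i}\tau^{i+j}$; an element acts on $\overline k$ by $\sum a_i\tau^i: x\mapsto\sum a_i x^{q^i}$. A Drinfeld module of rank $r$ over $k$ is an $\mathbb F_q$-algebra homomorphism $\phi:A\to k\{\tau\}$, $a\mapsto\phi_a$, with $\phi_T=\gamma(T)+g_1\tau+\dots+g_r\tau^r$, $g_r\neq 0$. Its height $h$ ($1\le h\le r$) is defined by: the lowest nonzero term of $\phi_{\mathfrak p}$ has $\tau$-degree $hd$; $\phi$ is supersingular if $h=r$. $\operatorname{End}(\phi)=\{u\in\overline k\{\tau\}: u\phi_a=\phi_a u\ \forall a\in A\}$, and for an integer $n\ge0$, $M_n(\phi)=\{0\}\cup\{u\in\operatorname{End}(\phi):u\ne0,\ \deg_\tau(u)\le n\}$, an $\mathbb F_q$-vector space. For $a\in A$ nonzero, $\phi[a]=\{\alpha\in\overline k:\phi_a(\alpha)=0\}$, an $A$-module via $b\cdot\alpha=\phi_b(\alpha)$. Since $\mathfrak q_i$ is prime to $\mathfrak p$, $\phi[\mathfrak q_i]\cong(A/\mathfrak q_i)^r\cong\mathbb F_{q^m}^r$. The map $\rho_i:\operatorname{End}(\phi)\to\operatorname{End}_{A/(\mathfrak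 q_i)}(\phi[\mathfrak q_i])\cong\operatorname{Mat}_{r\times r}(\mathbb F_{q^m})$ is restriction to $\mathfrak q_i$-torsion (with fixed bases and fixed isomorphisms $A/\mathfrak q_i\cong\mathbb F_{q^m}$). The code in question is $\{(\rho_i(u))_i:u\in M_s(\phi)\}$, with the sum-rank weight $\operatorname{wt}_{SR}(X)=\sum_i\operatorname{rk}_{\mathbb F_{q^m}}(X_i)$ and minimum distance $d_{SR}$ equal to the minimum weight of a nonzero codeword; the unique-decoding radius is $\lfloor(d_{SR}-1)/2\rfloor$. Filter decoder, with parameters $\varepsilon,\lambda\in\mathbb Z_{\ge0}$ such that $\dim_{\mathbb F_q}M_\lambda(\phi)>mr\varepsilon$ and $\lambda+s<m(\ell r-\varepsilon)$. Input: $(Y_1,\dots,Y_\ell)\in\operatorname{Mat}_{r\times r}(\mathbb F_{q^m})^\ell$. Output: an element $\widehat u\in M_s(\phi)$, or failure. (1) Solve the homogeneous $\mathbb F_q$-linear system $\rho_i(v)Y_i=\rho_i(N)$, $i=1,\dots,\ell$, for $(v,N)\in M_\lambda(\phi)\times M_{\lambda+s}(\phi)$. If the only solution is $(0,0)$, fail; otherwise choose any nonzero solution and fail if $v=0$. (2) Divide $N$ by $v$ on the left in the Ore ring: $N=v\widehat u+\Delta$ with $\deg_\tau(\Delta)<\deg_\tau(v)$. Fail if $\Delta\neq0$ or $\widehat u\notin M_s(\phi)$. (3) Fail if $\sum_i\operatorname{rk}_{\mathbb F_{q^m}}(Y_i-\rho_i(\widehat u))>\varepsilon$; otherwise return $\widehat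 u$. *)

theory Defs
  imports "HOL-Analysis.Analysis" "HOL-Computational_Algebra.Computational_Algebra"
begin

text \<open>
  Throughout, \<open>'f\<close> is the finite field with \<open>q = CARD('f)\<close> elements, \<open>A = 'f poly\<close>, and ideals of
  \<open>A\<close> are represented by their monic generators. A finite family indexed by \<open>1, \<dots>, \<ell>\<close> is a
  function on a finite type \<open>'l\<close> with \<open>\<ell> = CARD('l)\<close>; likewise \<open>r = CARD('r)\<close>.
\<close>

text \<open>A ring homomorphism out of \<open>A\<close> with kernel \<open>(\<pp>)\<close>, i.e. an embedding of \<open>A/\<pp>\<close>.\<close>

definition residue_embedding :: "'f::field poly \<Rightarrow> ('f poly \<Rightarrow> 'k::field) \<Rightarrow> bool" where
  "residue_embedding \<pp> \<gamma> \<longleftrightarrow>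
     \<gamma> 1 = 1 \<and> (\<forall>a b. \<gamma> (a + b) = \<gamma> a + \<gamma> b) \<and> (\<forall>a b. \<gamma> (a * b) = \<gamma> a * \<gamma> b) \<and>
     (\<forall>a. \<gamma> a = 0 \<longleftrightarrow> \<pp> dvd a)"

definition residue_iso :: "'f::field poly \<Rightarrow> ('f poly \<Rightarrow> 'e::field) \<Rightarrow> bool" where
  "residue_iso \<qq> \<iota> \<longleftrightarrow> residue_embedding \<qq> \<iota> \<and> surj \<iota>"

text \<open>
  The class constraint makes \<open>'k\<close> algebraically closed, so \<open>\<gamma>\<close> exhibits it as an algebraic closure of
  \<open>A/\<pp>\<close>; below, \<open>'k\<close> also serves as its own algebraic closure in endomorphisms and torsion.
\<close>

definition residue_alg_closure :: "'f::field poly \<Rightarrow> ('f poly \<Rightarrow> 'k::alg_closed_field) \<Rightarrow> bool" where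
  "residue_alg_closure \<pp> \<gamma> \<longleftrightarrow> residue_embedding \<pp> \<gamma> \<and>
     (\<forall>x. \<exists>f. f \<noteq> 0 \<and> (\<forall>i. coeff f i \<in> range \<gamma>) \<and> poly f x = 0)"

text \<open>
  A twisted polynomial \<open>\<Sum> a\<^sub>i \<tau>\<^sup>i\<close> is stored as the ordinary polynomial with the same coefficients:
  addition, \<^const>\<open>coeff\<close> and \<^const>\<open>degree\<close> are shared, but the product is \<open>ore_mult\<close> and the action
  on the field is \<open>ore_eval\<close>.
\<close>

definition ore_mult :: "nat \<Rightarrow> 'k::field poly \<Rightarrow> 'k poly \<Rightarrow> 'k poly" where
  "ore_mult q u v =
     (\<Sum>i\<le>degree u. \<Sum>j\<le>degree v. monom (coeff u i * coeff v j ^ (q ^ i)) (i + j))"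

definition ore_eval :: "nat \<Rightarrow> 'k::field poly \<Rightarrow> 'k \<Rightarrow> 'k" where
  "ore_eval q u x = (\<Sum>i\<le>degree u. coeff u i * x ^ (q ^ i))"

text \<open>
  Quotient and remainder of \<open>N = v w + \<Delta>\<close>; they exist and are unique for \<open>v \<noteq> 0\<close> when the
  coefficient field is perfect. The disjunct \<open>\<Delta> = 0\<close> is needed because \<^term>\<open>degree 0 = 0\<close>.
\<close>

definition ore_left_div :: "nat \<Rightarrow> 'k::field poly \<Rightarrow> 'k poly \<Rightarrow> 'k poly \<times> 'k poly" where
  "ore_left_div q N v =
     (THE z. N = ore_mult q v (fst z) + snd z \<and> (snd z = 0 \<or> degree (snd z) < degree v))"

definition drinfeld_module ::
  "('f::{field,finite} poly \<Rightarrow> 'k::field) \<Rightarrow> nat \<Rightarrow> ('f poly \<Rightarrow> 'k poly) \<Rightarrow> bool" where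
  "drinfeld_module \<gamma> r \<phi> \<longleftrightarrow>
     (\<forall>c. \<phi> [:c:] = [:\<gamma> [:c:]:]) \<and>
     (\<forall>a b. \<phi> (a + b) = \<phi> a + \<phi> b) \<and>
     (\<forall>a b. \<phi> (a * b) = ore_mult CARD('f) (\<phi> a) (\<phi> b)) \<and>
     coeff (\<phi> [:0, 1:]) 0 = \<gamma> [:0, 1:] \<and>
     1 \<le> r \<and> degree (\<phi> [:0, 1:]) = r"

definition has_height :: "'f::field poly \<Rightarrow> ('f poly \<Rightarrow> 'k::field poly) \<Rightarrow> nat \<Rightarrow> bool" where
  "has_height \<pp> \<phi> h \<longleftrightarrow>
     coeff (\<phi> \<pp>) (h * degree \<pp>) \<noteq> 0 \<and> (\<forall>j < h * degree \<pp>. coeff (\<phi> \<pp>) j = 0)"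

definition supersingular :: "'f::field poly \<Rightarrow> nat \<Rightarrow> ('f poly \<Rightarrow> 'k::field poly) \<Rightarrow> bool" where
  "supersingular \<pp> r \<phi> \<longleftrightarrow> has_height \<pp> \<phi> r"

definition drinfeld_End :: "('f::{field,finite} poly \<Rightarrow> 'k::field poly) \<Rightarrow> 'k poly set" where
  "drinfeld_End \<phi> = {u. \<forall>a. ore_mult CARD('f) u (\<phi> a) = ore_mult CARD('f) (\<phi> a) u}"

definition End_le :: "('f::{field,finite} poly \<Rightarrow> 'k::field poly) \<Rightarrow> nat \<Rightarrow> 'k poly set" where
  "End_le \<phi> n = {0} \<union> {u \<in> drinfeld_End \<phi>. u \<noteq> 0 \<and> degree u \<le> n}"

definition dim_Fq :: "('f::field poly \<Rightarrow> 'k::field) \<Rightarrow> 'k poly set \<Rightarrow> nat" where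
  "dim_Fq \<gamma> V = vector_space.dim (\<lambda>(c::'f) u. smult (\<gamma> [:c:]) u) V"

definition torsion :: "('f::{field,finite} poly \<Rightarrow> 'k::field poly) \<Rightarrow> 'f poly \<Rightarrow> 'k set" where
  "torsion \<phi> a = {x. ore_eval CARD('f) (\<phi> a) x = 0}"

definition torsion_comb ::
  "('f::{field,finite} poly \<Rightarrow> 'k::field poly) \<Rightarrow> ('r::finite \<Rightarrow> 'k) \<Rightarrow> ('r \<Rightarrow> 'f poly) \<Rightarrow> 'k" where
  "torsion_comb \<phi> b a = (\<Sum>j\<in>UNIV. ore_eval CARD('f) (\<phi> (a j)) (b j))"

text \<open>\<open>b\<close> is an \<open>A/\<qq>\<close>-basis of \<open>\<phi>[\<qq>]\<close>; scalars in \<open>A/\<qq>\<close> are given by representatives in \<open>A\<close>.\<close>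

definition torsion_basis ::
  "('f::{field,finite} poly \<Rightarrow> 'k::field poly) \<Rightarrow> 'f poly \<Rightarrow> ('r::finite \<Rightarrow> 'k) \<Rightarrow> bool" where
  "torsion_basis \<phi> \<qq> b \<longleftrightarrow>
     range b \<subseteq> torsion \<phi> \<qq> \<and>
     (\<forall>x \<in> torsion \<phi> \<qq>. \<exists>a. x = torsion_comb \<phi> b a) \<and>
     (\<forall>a. torsion_comb \<phi> b a = 0 \<longrightarrow> (\<forall>j. \<qq> dvd a j))"

definition torsion_coords ::
  "('f::{field,finite} poly \<Rightarrow> 'k::field poly) \<Rightarrow> ('f poly \<Rightarrow> 'e) \<Rightarrow> ('r::finite \<Rightarrow> 'k) \<Rightarrow> 'k \<Rightarrow> 'e ^ 'r"
  where
  "torsion_coords \<phi> \<iota> b x =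
     (THE c. \<exists>a. (\<forall>j. \<iota> (a j) = c $ j) \<and> x = torsion_comb \<phi> b a)"

text \<open>
  The matrix of \<open>u\<close> restricted to the torsion, acting on column vectors (column \<open>j\<close> holds the
  coordinates of \<open>u (b j)\<close>), so that composition corresponds to the matrix product.
\<close>

definition torsion_rep ::
  "('f::{field,finite} poly \<Rightarrow> 'k::field poly) \<Rightarrow> ('f poly \<Rightarrow> 'e) \<Rightarrow> ('r::finite \<Rightarrow> 'k) \<Rightarrow>
     'k poly \<Rightarrow> 'e ^ 'r ^ 'r" where
  "torsion_rep \<phi> \<iota> b u = (\<chi> i j. torsion_coords \<phi> \<iota> b (ore_eval CARD('f) u (b j)) $ i)"

definition wt_SR :: "('l::finite \<Rightarrow> 'e::field ^ 'r::finite ^ 'r) \<Rightarrow> nat" where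
  "wt_SR X = (\<Sum>i\<in>UNIV. rank (X i))"

definition min_dist_SR :: "('l::finite \<Rightarrow> 'e::field ^ 'r::finite ^ 'r) set \<Rightarrow> nat" where
  "min_dist_SR C = (LEAST w. \<exists>X\<in>C. X \<noteq> (\<lambda>_. 0) \<and> wt_SR X = w)"

definition drinfeld_code ::
  "('f::{field,finite} poly \<Rightarrow> 'k::field poly) \<Rightarrow> ('l::finite \<Rightarrow> 'k poly \<Rightarrow> 'e ^ 'r ^ 'r) \<Rightarrow> nat \<Rightarrow>
     ('l \<Rightarrow> 'e ^ 'r::finite ^ 'r) set" where
  "drinfeld_code \<phi> \<rho> s = (\<lambda>u i. \<rho> i u) ` End_le \<phi> s"

definition filter_params ::
  "('f::{field,finite} poly \<Rightarrow> 'k::field) \<Rightarrow> ('f poly \<Rightarrow> 'k poly) \<Rightarrow>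
     nat \<Rightarrow> nat \<Rightarrow> nat \<Rightarrow> nat \<Rightarrow> nat \<Rightarrow> int \<Rightarrow> bool" where
  "filter_params \<gamma> \<phi> m r l s lam \<epsilon> \<longleftrightarrow>
     0 \<le> \<epsilon> \<and>
     int (dim_Fq \<gamma> (End_le \<phi> lam)) > int (m * r) * \<epsilon> \<and>
     int (lam + s) < int m * (int (l * r) - \<epsilon>)"

definition filter_solutions ::
  "('f::{field,finite} poly \<Rightarrow> 'k::field poly) \<Rightarrow> ('l::finite \<Rightarrow> 'k poly \<Rightarrow> 'e::field ^ 'r::finite ^ 'r) \<Rightarrow>
     nat \<Rightarrow> nat \<Rightarrow> ('l \<Rightarrow> 'e ^ 'r ^ 'r) \<Rightarrow> ('k poly \<times> 'k poly) set" where
  "filter_solutions \<phi> \<rho> s lam Y =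
     {(v, N). v \<in> End_le \<phi> lam \<and> N \<in> End_le \<phi> (lam + s) \<and> (\<forall>i. \<rho> i v ** Y i = \<rho> i N)}"

definition filter_finish ::
  "('f::{field,finite} poly \<Rightarrow> 'k::field poly) \<Rightarrow> ('l::finite \<Rightarrow> 'k poly \<Rightarrow> 'e::field ^ 'r::finite ^ 'r) \<Rightarrow>
     nat \<Rightarrow> int \<Rightarrow> ('l \<Rightarrow> 'e ^ 'r ^ 'r) \<Rightarrow> 'k poly \<times> 'k poly \<Rightarrow> 'k poly option" where
  "filter_finish \<phi> \<rho> s \<epsilon> Y = (\<lambda>(v, N).
     if v = 0 then None
     else let (w, \<Delta>) = ore_left_div CARD('f) N v in
       if \<Delta> \<noteq> 0 \<or> w \<notin> End_le \<phi> s then None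
       else if int (wt_SR (\<lambda>i. Y i - \<rho> i w)) > \<epsilon> then None
       else Some w)"

text \<open>
  The decoder may continue with any nonzero solution; this is the set of all its possible outcomes,
  \<^const>\<open>None\<close> standing for failure.
\<close>

definition filter_decoder ::
  "('f::{field,finite} poly \<Rightarrow> 'k::field poly) \<Rightarrow> ('l::finite \<Rightarrow> 'k poly \<Rightarrow> 'e::field ^ 'r::finite ^ 'r) \<Rightarrow>
     nat \<Rightarrow> nat \<Rightarrow> int \<Rightarrow> ('l \<Rightarrow> 'e ^ 'r ^ 'r) \<Rightarrow> 'k poly option set" where
  "filter_decoder \<phi> \<rho> s lam \<epsilon> Y =
     (let S = filter_solutions \<phi> \<rho> s lam Y - {(0, 0)}
      in if S = {} then {None} else filter_finish \<phi> \<rho> s \<epsilon> Y ` S)"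

definition filter_decoder_corrects ::
  "('f::{field,finite} poly \<Rightarrow> 'k::field poly) \<Rightarrow> ('l::finite \<Rightarrow> 'k poly \<Rightarrow> 'e::field ^ 'r::finite ^ 'r) \<Rightarrow>
     nat \<Rightarrow> nat \<Rightarrow> int \<Rightarrow> bool" where
  "filter_decoder_corrects \<phi> \<rho> s lam \<epsilon> \<longleftrightarrow>
     (\<forall>u \<in> End_le \<phi> s. \<forall>E. int (wt_SR E) \<le> \<epsilon> \<longrightarrow>
        filter_decoder \<phi> \<rho> s lam \<epsilon> (\<lambda>i. \<rho> i u + E i) = {Some u})"

definition filter_radius ::
  "('f::{field,finite} poly \<Rightarrow> 'k::field) \<Rightarrow> ('f poly \<Rightarrow> 'k poly) \<Rightarrow>
     nat \<Rightarrow> nat \<Rightarrow> nat \<Rightarrow> nat \<Rightarrow> nat \<Rightarrow> int" where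
  "filter_radius \<gamma> \<phi> m r l t lam =
     min \<lfloor>(real (dim_Fq \<gamma> (End_le \<phi> lam)) - 1) / real (m * r)\<rfloor>
         \<lfloor>(real m * (real (l * r) - real t) - real lam) / real m\<rfloor>"

end

theory Submission
  imports Defs
begin

text \<open>
  Each basis identifies \<open>\<phi>[\<qq>\<^sub>i]\<close> with column vectors on which an endomorphism \<open>u\<close> acts as \<open>\<rho>\<^sub>i(u)\<close>.
  The torsion modules at distinct \<open>\<qq>\<^sub>i\<close> are independent in \<open>k\<close>, while \<open>u \<noteq> 0\<close> has at most
  \<open>q\<^bsup>deg u\<^esup>\<close> roots; hence \<open>m \<Sum>\<^sub>i dim ker \<rho>\<^sub>i(u) \<le> deg u\<close>. For a solution \<open>(v, N)\<close> of the filter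
  equations, \<open>\<rho>\<^sub>i(N - v u) = \<rho>\<^sub>i(v) E\<^sub>i\<close> kills \<open>ker E\<^sub>i\<close>, which gives \<open>N - v u\<close> too many roots, so
  \<open>N = v u\<close>. A nonzero solution exists by the pigeonhole principle: the rows of \<open>\<rho>\<^sub>i(v) E\<^sub>i\<close> lie in
  the row space of \<open>E\<^sub>i\<close>, so \<open>v \<mapsto> (\<rho>\<^sub>i(v) E\<^sub>i)\<^sub>i\<close> is not injective on \<open>M\<^sub>\<lambda>(\<phi>)\<close>.

  In characteristic \<open>(T)\<close>, supersingularity means \<open>\<phi>\<^sub>T = g \<tau>\<^sup>r\<close>. Commuting with it is a separable
  equation of degree \<open>q\<^sup>r\<close> on each coefficient separately, so \<open>dim M\<^sub>n(\<phi>) = r (n + 1)\<close>.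
\<close>

section \<open>Counting over finite fields\<close>

text \<open>Coordinates in a basis identify \<open>V\<close> with
  \<open>B \<rightarrow>\<^sub>E UNIV\<close>. Through this, dimension arguments are carried out by
  counting elements.\<close>

lemma card_finite_vector_space:
  fixes scale :: "'a::{field,finite} \<Rightarrow> 'b::ab_group_add \<Rightarrow> 'b"
  assumes "vector_space scale" "module.subspace scale V" "finite V"
  shows "card V = CARD('a) ^ vector_space.dim scale V"
proof -
  interpret vector_space scale by fact
  obtain B where B: "B \<subseteq> V" "independent B" "V \<subseteq> span B" "card B = dim V"
    using basis_exists by blast
  have fin: "finite B" using B(1) assms(3) finite_subset by blast
  define f where "f = (\<lambda>c. \<Sum>b\<in>B. scale (c b) b)"
  have "inj_on f (B \<rightarrow>\<^sub>E UNIV)"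
  proof (rule inj_onI)
    fix c c' assume c: "c \<in> B \<rightarrow>\<^sub>E UNIV" "c' \<in> B \<rightarrow>\<^sub>E UNIV" "f c = f c'"
    then have "(\<Sum>b\<in>B. scale (c b - c' b) b) = 0"
      by (simp add: f_def scale_left_diff_distrib sum_subtractf)
    then have "\<forall>b\<in>B. c b - c' b = 0"
      using independentD[OF B(2) fin subset_refl, of "\<lambda>b. c b - c' b"] by blast
    with c show "c = c'" by (auto intro: PiE_ext)
  qed
  moreover have "f ` (B \<rightarrow>\<^sub>E UNIV) = V"
  proof
    show "f ` (B \<rightarrow>\<^sub>E UNIV) \<subseteq> V"
      unfolding f_def using B(1) assms(2) by (auto intro!: subspace_sum subspace_scale)
    show "V \<subseteq> f ` (B \<rightarrow>\<^sub>E UNIV)"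
    proof
      fix x assume "x \<in> V"
      then obtain c where "x = (\<Sum>b\<in>B. scale (c b) b)"
        using B(3) span_finite[OF fin] by auto
      then have "x = f (restrict c B)" by (simp add: f_def)
      have "restrict c B \<in> B \<rightarrow>\<^sub>E UNIV" by simp
      with \<open>x = f (restrict c B)\<close> show "x \<in> f ` (B \<rightarrow>\<^sub>E UNIV)" by (metis imageI)
    qed
  qed
  ultimately have "card V = card (B \<rightarrow>\<^sub>E (UNIV :: 'a set))"
    by (metis card_image)
  then show ?thesis
    using fin by (simp add: card_PiE B(4))
qed

section \<open>Row spaces, kernels and sum-rank weight\<close>

lemma card_row_space:
  fixes M :: "'e::{field,finite} ^ 'n ^ 'm"
  shows "card (vec.span (rows M)) = CARD('e) ^ rank M"
proof -
  have "card (vec.span (rows M)) = CARD('e) ^ vec.dim (vec.span (rows M))"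
    by (intro card_finite_vector_space vec.vector_space_axioms vec.subspace_span) simp
  then show ?thesis by (simp add: vec.dim_span row_rank_def_gen)
qed

lemma matrix_mult_row_in_span:
  fixes M :: "'e::field ^ 'n ^ 'm" and X :: "'e ^ 'm ^ 'k"
  shows "(X ** M) $ i \<in> vec.span (rows M)"
proof -
  have "(X ** M) $ i = (\<Sum>j\<in>UNIV. X $ i $ j *s (M $ j))"
    by (simp add: vec_eq_iff matrix_matrix_mult_def)
  moreover have "M $ j \<in> rows M" for j
    by (auto simp: rows_def row_def)
  ultimately show ?thesis
    by (simp add: vec.span_sum vec.span_scale vec.span_base)
qed

text \<open>Each of the \<open>CARD('k)\<close> rows of the product is one vector of the row space
  of \<open>M\<close>. This bounds the number of error terms \<open>rho i v ** E i\<close>.\<close>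

lemma card_left_multiples_le:
  fixes M :: "'e::{field,finite} ^ 'n ^ 'm"
  shows "card (range (\<lambda>X :: 'e ^ 'm ^ 'k. X ** M)) \<le> (CARD('e) ^ rank M) ^ CARD('k)"
proof -
  have "range (\<lambda>X :: 'e ^ 'm ^ 'k. X ** M) \<subseteq> vec_lambda ` (UNIV \<rightarrow>\<^sub>E vec.span (rows M))"
  proof
    fix Y assume "Y \<in> range (\<lambda>X :: 'e ^ 'm ^ 'k. X ** M)"
    then have "(\<lambda>i. Y $ i) \<in> UNIV \<rightarrow>\<^sub>E vec.span (rows M)"
      by (auto intro: matrix_mult_row_in_span)
    then show "Y \<in> vec_lambda ` (UNIV \<rightarrow>\<^sub>E vec.span (rows M))"
      by (metis imageI vec_lambda_eta)
  qed
  then have "card (range (\<lambda>X :: 'e ^ 'm ^ 'k. X ** M)) \<le> card ((UNIV :: 'k set) \<rightarrow>\<^sub>E vec.span (rows M))"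
    by (intro surj_card_le) (auto intro: finite_PiE)
  then show ?thesis
    by (simp add: card_PiE card_row_space)
qed

text \<open>The library defines \<^const>\<open>rank\<close> as the row rank and proves it equal to the column rank only
  over the reals; here the kernel is cut out by the equations of a basis of the row space.\<close>
lemma card_kernel_ge:
  fixes M :: "'e::{field,finite} ^ 'n ^ 'm"
  shows "CARD('e) ^ (CARD('n) - rank M) \<le> card {c. M *v c = 0}"
proof -
  obtain B where B: "B \<subseteq> rows M" "rows M \<subseteq> vec.span B" "card B = rank M"
    using vec.basis_exists[of "rows M"] unfolding row_rank_def_gen by metis
  define dot where "dot = (\<lambda>(x :: 'e ^ 'n) c. \<Sum>j\<in>UNIV. x $ j * c $ j)"
  define K where "K = {c. M *v c = 0}"
  define g where "g = (\<lambda>c. restrict (\<lambda>x. dot x c) B)"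
  have span: "dot x c = 0" if "\<forall>y\<in>B. dot y c = 0" "x \<in> vec.span B" for x c
    using that(2)
  proof (induction rule: vec.span_induct_alt)
    case base
    show ?case by (simp add: dot_def)
  next
    case (step a y z)
    have "dot (a *s y + z) c = a * dot y c + dot z c"
      by (simp add: dot_def algebra_simps sum.distrib sum_distrib_left)
    with step show ?case using that(1) by simp
  qed
  have K: "c - c' \<in> K" if "g c = g c'" for c c'
  proof -
    have "dot y c = dot y c'" if "y \<in> B" for y
      using fun_cong[OF \<open>g c = g c'\<close>, of y] that by (simp add: g_def)
    moreover have "dot y (c - c') = dot y c - dot y c'" for y
      by (simp add: dot_def right_diff_distrib sum_subtractf)
    ultimately have "\<forall>y\<in>B. dot y (c - c') = 0" by simp
    then have "dot (row i M) (c - c') = 0" for i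
      using B(2) span by (auto simp: rows_def)
    then show ?thesis by (simp add: K_def dot_def row_def vec_eq_iff matrix_vector_mult_def)
  qed
  \<comment> \<open>Subtracting one point of a fibre moves the fibre injectively into the kernel; as
    \<open>g\<close> has at most \<open>CARD('e) ^ rank M\<close> fibres, the kernel must be
    large.\<close>
  have fib: "card (g -` {y}) \<le> card K" for y
  proof (cases "g -` {y} = {}")
    case False
    then obtain c where c: "g c = y" by auto
    have "(\<lambda>c'. c' - c) ` (g -` {y}) \<subseteq> K"
      using K c by auto
    then show ?thesis
      by (intro card_inj_on_le[of "\<lambda>c'. c' - c"]) (auto simp: inj_on_def)
  qed simp
  have "CARD('e) ^ CARD('n) = card (\<Union>y\<in>range g. g -` {y})"
    by (subst CARD_vec[symmetric], rule arg_cong[of _ _ card], blast)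
  also have "\<dots> \<le> (\<Sum>y\<in>range g. card (g -` {y}))"
    by (rule card_UN_le) simp
  also have "\<dots> \<le> card (range g) * card K"
    using sum_bounded_above[of "range g" "\<lambda>y. card (g -` {y})" "card K"] fib by simp
  also have "card (range g) \<le> card (B \<rightarrow>\<^sub>E (UNIV :: 'e set))"
    by (intro card_mono finite_PiE) (auto simp: g_def)
  also have "\<dots> = CARD('e) ^ rank M"
    by (simp add: card_PiE B(3))
  finally have le: "CARD('e) ^ CARD('n) \<le> CARD('e) ^ rank M * card K" by simp
  show ?thesis
  proof (cases "rank M \<le> CARD('n)")
    case True
    then have "CARD('e) ^ CARD('n) = CARD('e) ^ rank M * CARD('e) ^ (CARD('n) - rank M)"
      by (simp flip: power_add)
    with le show ?thesis by (simp add: K_def)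
  next
    \<comment> \<open>Natural subtraction truncates here, so the claim becomes
      \<open>1 \<le> card K\<close>.\<close>
    case False
    have "0 \<in> K" by (simp add: K_def)
    then have "card K > 0" by (auto simp: card_gt_0_iff)
    with False show ?thesis by (simp add: K_def)
  qed
qed

lemma rank_le_nonzero_rows:
  fixes M :: "'e::field ^ 'n ^ 'm"
  shows "rank M \<le> card {i. M $ i \<noteq> 0}"
proof -
  have "rows M \<subseteq> vec.span ((\<lambda>i. M $ i) ` {i. M $ i \<noteq> 0})"
  proof
    fix x assume "x \<in> rows M"
    then obtain i where "x = M $ i" by (auto simp: rows_def row_def)
    then show "x \<in> vec.span ((\<lambda>i. M $ i) ` {i. M $ i \<noteq> 0})"
      by (cases "x = 0") (auto intro: vec.span_zero vec.span_base)
  qed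
  then have "rank M \<le> card ((\<lambda>i. M $ i) ` {i. M $ i \<noteq> 0})"
    unfolding row_rank_def_gen by (intro vec.dim_le_card) auto
  also have "\<dots> \<le> card {i. M $ i \<noteq> 0}" by (intro card_image_le) simp
  finally show ?thesis .
qed

lemma matrix_diff_left:
  fixes A B :: "'a::ring_1 ^ 'n ^ 'm" and M :: "'a ^ 'p ^ 'n"
  shows "(A - B) ** M = A ** M - B ** M"
  by (simp add: vec_eq_iff matrix_matrix_mult_def left_diff_distrib sum_subtractf)

text \<open>The rank bound by nonzero rows is summed over the blocks. Forcing rows to vanish thereby
  limits the weight, as the Singleton argument needs.\<close>

lemma wt_SR_le_nonzero_rows:
  fixes X :: "'l::finite \<Rightarrow> 'e::field ^ 'r::finite ^ 'r"
  shows "wt_SR X \<le> card {(i, j). X i $ j \<noteq> 0}"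
proof -
  have "wt_SR X \<le> (\<Sum>i\<in>UNIV. card {j. X i $ j \<noteq> 0})"
    unfolding wt_SR_def by (intro sum_mono rank_le_nonzero_rows)
  also have "\<dots> = card (SIGMA i:UNIV. {j. X i $ j \<noteq> 0})"
    by (simp add: card_SigmaI)
  also have "(SIGMA i:UNIV. {j. X i $ j \<noteq> 0}) = {(i, j). X i $ j \<noteq> 0}"
    by auto
  finally show ?thesis .
qed

lemma wt_SR_0: "wt_SR (\<lambda>_ :: 'l::finite. 0 :: 'e::field ^ 'r::finite ^ 'r) = 0"
  using wt_SR_le_nonzero_rows[of "\<lambda>_. 0"] by simp

lemma monic_dvd_same_degree:
  fixes p q :: "'a::field poly"
  assumes "p dvd q" "lead_coeff p = 1" "lead_coeff q = 1" "degree p = degree q"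
  shows "p = q"
proof -
  obtain c where c: "q = p * c" using assms(1) by (rule dvdE)
  have "p \<noteq> 0" "c \<noteq> 0" using assms c by auto
  then have "degree c = 0" using assms(4) by (simp add: c degree_mult_eq)
  moreover have "lead_coeff c = 1" using assms(2,3) by (simp add: c lead_coeff_mult)
  ultimately have "c = 1" by (metis degree_0_id lead_coeff_pCons(1) of_nat_1 one_pCons degree_eq_zeroE pCons_0_0 coeff_pCons_0)
  then show ?thesis by (simp add: c)
qed

text \<open>Multiplication by a nonzero \<open>x\<close> permutes the nonzero elements; comparing
  their products gives \<open>x ^ (CARD('f) - 1) = 1\<close>.\<close>

lemma finite_field_power_card:
  fixes x :: "'f::{field,finite}"
  shows "x ^ CARD('f) = x"
proof (cases "x = 0")
  case False
  have "(\<Prod>y\<in>UNIV-{0}. y) = (\<Prod>y\<in>UNIV-{0}. x * y)"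
    by (rule prod.reindex_bij_witness[of _ "\<lambda>y. x * y" "\<lambda>y. y / x"]) (use False in auto)
  also have "\<dots> = x ^ (CARD('f) - 1) * (\<Prod>y\<in>UNIV-{0}. y)"
    by (simp add: prod.distrib card_Diff_subset)
  finally have "x ^ (CARD('f) - 1) = 1"
    by simp
  then have "x * x ^ (CARD('f) - 1) = x" by simp
  then show ?thesis by (simp flip: power_Suc)
qed simp

text \<open>Both sides of \<open>(1 + X)\<^sup>q = 1 + X\<^sup>q\<close> agree on the whole field, which has more elements than
  the degree of their difference.\<close>
lemma finite_field_card_choose_eq_0:
  assumes "0 < j" "j < CARD('f)"
  shows "of_nat (CARD('f) choose j) = (0 :: 'f::{field,finite})"
proof -
  define q where "q = CARD('f)"
  define P where "P = [:1, 1 :: 'f:] ^ q - monom 1 q - 1"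
  have co: "coeff ([:1, 1 :: 'f:] ^ q) i = of_nat (q choose i)" if "i \<le> q" for i
    using coeff_linear_poly_power[of i q 1 "1::'f"] that by simp
  have root: "poly P x = 0" for x
    by (simp add: P_def poly_monom q_def finite_field_power_card)
  have "P = 0"
  proof (rule ccontr)
    assume "P \<noteq> 0"
    then have "CARD('f) \<le> degree P" using card_poly_roots_bound[of P] root by simp
    moreover have "degree P \<le> q"
      unfolding P_def by (intro degree_diff_le) (auto simp: degree_linear_power degree_monom_eq)
    moreover have "coeff P q = 0"
      using assms by (simp add: P_def coeff_linear_power q_def)
    ultimately show False using \<open>P \<noteq> 0\<close> by (metis le_antisym leading_coeff_0_iff q_def)
  qed
  then have "coeff P j = 0" by simp
  then show ?thesis using assms co[of j] by (simp add: P_def coeff_1 q_def)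
qed

section \<open>Root counts over an algebraically closed field\<close>

lemma infinite_UNIV_alg_closed: "infinite (UNIV :: 'k::alg_closed_field set)"
proof
  assume fin: "finite (UNIV :: 'k set)"
  \<comment> \<open>\<open>P + 1\<close> would take the value 1 everywhere although its degree is
    positive.\<close>
  define P where "P = (\<Prod>a\<in>(UNIV::'k set). [:- a, 1:])"
  have "degree P = CARD('k)"
    unfolding P_def by (subst degree_prod_eq_sum_degree) auto
  then have "degree (P + 1) > 0"
    using fin by (subst degree_add_eq_left) (auto simp: card_gt_0_iff)
  then obtain x where "poly (P + 1) x = 0" using alg_closed_imp_poly_has_root by blast
  moreover have "poly P x = 0"
    unfolding P_def poly_prod using fin by (intro prod_zero) (auto intro: bexI[of _ x])
  ultimately show False by simp
qed

text \<open>The polynomial splits, so its degree counts roots with multiplicity; a multiple root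
  would also be a root of the derivative.\<close>

lemma card_roots_separable:
  fixes p :: "'k::alg_closed_field poly"
  assumes "p \<noteq> 0" and simple: "\<And>a. poly p a = 0 \<Longrightarrow> poly (pderiv p) a \<noteq> 0"
  shows "card {x. poly p x = 0} = degree p"
proof -
  obtain A where A: "size A = degree p" "p = smult (lead_coeff p) (\<Prod>x\<in>#A. [:-x, 1:])"
    using alg_closed_imp_factorization[OF assms(1)] by blast
  have "proots (\<Prod>x\<in>#A. [:-x, 1:]) = A"
  proof (induction A)
    case (add x A)
    have "(\<Prod>x\<in>#A. [:- x, 1:]) \<noteq> 0" by (auto simp: prod_mset_zero_iff)
    then have "proots ([:- x, 1:] * (\<Prod>x\<in>#A. [:- x, 1:])) = {#x#} + A"
      by (subst proots_mult) (auto simp: add.IH)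
    then show ?case by simp
  qed simp
  then have pr: "proots p = A" using A(2) \<open>p \<noteq> 0\<close>
    by (metis leading_coeff_0_iff proots_smult)
  have order: "order a p = 1" if "poly p a = 0" for a
  proof (rule antisym)
    show "1 \<le> order a p"
      using that \<open>p \<noteq> 0\<close> by (simp add: order_root Suc_le_eq)
    show "order a p \<le> 1"
    proof (rule ccontr)
      assume "\<not> order a p \<le> 1"
      then have "[:- a, 1:] ^ 2 dvd p"
        by (intro order_divides[THEN iffD2]) simp
      then obtain g where "p = [:- a, 1:] ^ 2 * g" by (rule dvdE)
      then have "poly (pderiv p) a = 0"
        by (simp only: power2_eq_square pderiv_mult poly_add poly_mult) simp
      then show False using simple that by blast
    qed
  qed
  have "degree p = (\<Sum>x\<in>set_mset (proots p). order x p)"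
    using \<open>p \<noteq> 0\<close> A(1) pr by (simp add: size_multiset_overloaded_eq flip: count_proots)
  also have "\<dots> = (\<Sum>x | poly p x = 0. 1)"
    using \<open>p \<noteq> 0\<close> order by (intro sum.cong) auto
  finally show ?thesis by simp
qed

section \<open>Twisted polynomials as additive maps\<close>

text \<open>Additivity of the \<open>q\<close>-th power and \<open>2 \<le> q\<close> are all that
  the twisted calculus uses about \<open>q\<close>; \<open>ty\<close> ties them to the field
  type.\<close>

locale ore_field =
  fixes q :: nat and ty :: "'k::alg_closed_field itself"
  assumes q_ge_2: "2 \<le> q"
    and frob_add: "\<And>x y :: 'k. (x + y) ^ q = x ^ q + y ^ q"
begin

lemma frob_pow_add: "(x + y :: 'k) ^ (q ^ i) = x ^ (q ^ i) + y ^ (q ^ i)"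
  by (induction i) (simp_all add: power_mult frob_add mult.commute[of q])

lemma frob_pow_0: "(0 :: 'k) ^ (q ^ i) = 0"
  using q_ge_2 by (simp add: zero_power)

lemma frob_pow_sum: "(\<Sum>a\<in>S. f a :: 'k) ^ (q ^ i) = (\<Sum>a\<in>S. f a ^ (q ^ i))"
  by (induction S rule: infinite_finite_induct) (simp_all add: frob_pow_add frob_pow_0)

lemma ore_eval_altdef:
  fixes u :: "'k poly"
  assumes "degree u \<le> n"
  shows "ore_eval q u x = (\<Sum>i\<le>n. coeff u i * x ^ (q ^ i))"
  unfolding ore_eval_def
  by (rule sum.mono_neutral_left) (use assms in \<open>auto simp: coeff_eq_0\<close>)

lemma ore_eval_0 [simp]: "ore_eval q 0 (x :: 'k) = 0"
  by (simp add: ore_eval_def)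

lemma ore_eval_add: "ore_eval q (u + v) (x :: 'k) = ore_eval q u x + ore_eval q v x"
proof -
  define n where "n = max (degree u) (degree v)"
  have "degree u \<le> n" "degree v \<le> n" "degree (u + v) \<le> n"
    by (auto simp: n_def degree_add_le)
  then show ?thesis
    by (simp add: ore_eval_altdef[where n = n] distrib_right sum.distrib)
qed

lemma ore_eval_smult: "ore_eval q (smult c u) (x :: 'k) = c * ore_eval q u x"
  by (simp add: ore_eval_altdef[where n = "degree u"] sum_distrib_left mult.assoc)

lemma ore_eval_diff: "ore_eval q (u - v) (x :: 'k) = ore_eval q u x - ore_eval q v x"
  using ore_eval_add[of "u - v" v x] by (simp add: algebra_simps)

lemma ore_eval_sum: "ore_eval q (\<Sum>a\<in>S. f a) (x :: 'k) = (\<Sum>a\<in>S. ore_eval q (f a) x)"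
  by (induction S rule: infinite_finite_induct) (simp_all add: ore_eval_add)

lemma ore_eval_monom: "ore_eval q (monom c n) (x :: 'k) = c * x ^ (q ^ n)"
  by (simp add: ore_eval_altdef[where n = n] degree_monom_le if_distrib[of "\<lambda>c. c * _"] cong: if_cong)

lemma ore_eval_add_right: "ore_eval q u (x + y :: 'k) = ore_eval q u x + ore_eval q u y"
  by (simp add: ore_eval_def frob_pow_add distrib_left sum.distrib)

lemma ore_eval_0_right [simp]: "ore_eval q u (0 :: 'k) = 0"
  by (simp add: ore_eval_def frob_pow_0)

lemma ore_eval_diff_right: "ore_eval q u (x - y :: 'k) = ore_eval q u x - ore_eval q u y"
  using ore_eval_add_right[of u "x - y" y] by (simp add: algebra_simps)

lemma ore_eval_sum_right:
  "ore_eval q u (\<Sum>a\<in>S. f a :: 'k) = (\<Sum>a\<in>S. ore_eval q u (f a))"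
  by (induction S rule: infinite_finite_induct) (simp_all add: ore_eval_add_right)

lemma ore_eval_mult: "ore_eval q (ore_mult q u v) (x :: 'k) = ore_eval q u (ore_eval q v x)"
proof -
  have "(c :: 'k) * (\<Sum>j\<le>degree v. coeff v j * x ^ (q ^ j)) ^ (q ^ i)
      = (\<Sum>j\<le>degree v. c * coeff v j ^ (q ^ i) * x ^ (q ^ (i + j)))" for c i
    unfolding frob_pow_sum sum_distrib_left
    by (intro sum.cong refl) (simp add: power_mult_distrib power_add mult.commute flip: power_mult)
  then show ?thesis
    by (simp add: ore_mult_def ore_eval_sum ore_eval_monom ore_eval_def[of q u] ore_eval_def[of q v])
qed

text \<open>The linearized polynomial with the same values as \<open>u\<close>; ordinary root and
  degree bounds reach twisted polynomials through it.\<close>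

definition ore_poly :: "'k poly \<Rightarrow> 'k poly" where
  "ore_poly u = (\<Sum>i\<le>degree u. monom (coeff u i) (q ^ i))"

lemma poly_ore_poly: "poly (ore_poly u) x = ore_eval q u x"
  by (simp add: ore_poly_def ore_eval_def poly_sum poly_monom)

lemma degree_ore_poly:
  assumes "u \<noteq> 0"
  shows "degree (ore_poly u) = q ^ degree u"
proof (rule antisym)
  show "degree (ore_poly u) \<le> q ^ degree u"
    unfolding ore_poly_def
    by (intro degree_sum_le) (auto intro!: degree_monom_le order_trans[OF degree_monom_le] power_increasing
      simp: q_ge_2 Suc_leI order_trans[OF _ q_ge_2])
  have "coeff (ore_poly u) (q ^ degree u) = lead_coeff u"
    using q_ge_2 by (simp add: ore_poly_def coeff_sum)
  then show "q ^ degree u \<le> degree (ore_poly u)"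
    using assms by (intro le_degree) auto
qed

lemma ore_poly_neq_0: "u \<noteq> 0 \<Longrightarrow> ore_poly u \<noteq> 0"
  using degree_ore_poly[of u] q_ge_2 by auto

lemma card_ore_roots:
  assumes "(u :: 'k poly) \<noteq> 0"
  shows "finite {x. ore_eval q u x = 0}" "card {x. ore_eval q u x = 0} \<le> q ^ degree u"
  using poly_roots_finite[of "ore_poly u"] card_poly_roots_bound[of "ore_poly u"]
    degree_ore_poly[OF assms] ore_poly_neq_0[OF assms]
  by (simp_all add: poly_ore_poly)

text \<open>Identities in the twisted polynomial ring are proved pointwise through this lemma.\<close>
lemma ore_eval_eqI:
  fixes u v :: "'k poly"
  assumes "\<And>x. ore_eval q u x = ore_eval q v x"
  shows "u = v"
proof (rule ccontr)
  assume "u \<noteq> v"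
  then have "finite {x. ore_eval q (u - v) x = 0}"
    by (intro card_ore_roots) simp
  then show False
    using assms infinite_UNIV_alg_closed[where ?'k = 'k] by (simp add: ore_eval_diff)
qed

lemma ore_mult_diff_right: "ore_mult q u (v - w) = ore_mult q u v - ore_mult q u (w :: 'k poly)"
  by (rule ore_eval_eqI) (simp add: ore_eval_mult ore_eval_diff ore_eval_diff_right)

text \<open>Twisted multiplication is composition of linearized polynomials, whose ordinary degrees
  \<open>q ^ degree u\<close> and \<open>q ^ degree v\<close> multiply.\<close>

lemma degree_ore_mult:
  fixes u v :: "'k poly"
  assumes "u \<noteq> 0" "v \<noteq> 0"
  shows "degree (ore_mult q u v) = degree u + degree v" "ore_mult q u v \<noteq> 0"
proof -
  have "poly (ore_poly (ore_mult q u v)) x = poly (pcompose (ore_poly u) (ore_poly v)) x" for x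
    by (simp add: poly_ore_poly poly_pcompose ore_eval_mult)
  then have "{x. poly (ore_poly (ore_mult q u v) - pcompose (ore_poly u) (ore_poly v)) x = 0} = UNIV"
    by simp
  then have eq: "ore_poly (ore_mult q u v) = pcompose (ore_poly u) (ore_poly v)"
    using poly_roots_finite infinite_UNIV_alg_closed[where ?'k = 'k] by (metis eq_iff_diff_eq_0)
  have deg: "degree (ore_poly (ore_mult q u v)) = q ^ (degree u + degree v)"
    using assms by (simp add: eq degree_pcompose degree_ore_poly power_add)
  then show nz: "ore_mult q u v \<noteq> 0"
    using q_ge_2 by (auto simp: ore_poly_def)
  show "degree (ore_mult q u v) = degree u + degree v"
    using deg q_ge_2 unfolding degree_ore_poly[OF nz] by simp
qed

text \<open>The \<open>THE\<close> needs uniqueness: another quotient would make the remainder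
  \<open>v\<close> times a nonzero element, hence of degree at least
  \<open>degree v\<close>.\<close>

lemma ore_left_div_exact:
  fixes v w :: "'k poly"
  assumes "v \<noteq> 0"
  shows "ore_left_div q (ore_mult q v w) v = (w, 0)"
  unfolding ore_left_div_def
proof (rule the_equality)
  fix z :: "'k poly \<times> 'k poly"
  assume z: "ore_mult q v w = ore_mult q v (fst z) + snd z \<and> (snd z = 0 \<or> degree (snd z) < degree v)"
  then have *: "snd z = ore_mult q v (w - fst z)"
    by (simp add: ore_mult_diff_right)
  have "w = fst z"
  proof (rule ccontr)
    assume "w \<noteq> fst z"
    then have "w - fst z \<noteq> 0" by simp
    from degree_ore_mult[OF assms this] z show False by (simp add: *)
  qed
  with z show "z = (w, 0)" by (simp add: prod_eq_iff)
qed simp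

end

section \<open>Endomorphisms and torsion\<close>

locale drinfeld =
  fixes \<gamma> :: "'f::{field,finite} poly \<Rightarrow> 'k::alg_closed_field"
    and \<phi> :: "'f poly \<Rightarrow> 'k poly" and r :: nat
  assumes gamma_1: "\<gamma> 1 = 1"
    and gamma_add: "\<And>a b. \<gamma> (a + b) = \<gamma> a + \<gamma> b"
    and gamma_mult: "\<And>a b. \<gamma> (a * b) = \<gamma> a * \<gamma> b"
    and drinfeld: "drinfeld_module \<gamma> r \<phi>"
begin

lemma gamma_0: "\<gamma> 0 = 0"
  using gamma_add[of 0 0] by (metis add_0 add_cancel_right_right)

lemma gamma_of_nat: "\<gamma> [:of_nat n:] = of_nat n"
proof (induction n)
  case (Suc n)
  have "[:of_nat (Suc n) :: 'f:] = 1 + [:of_nat n:]" by (simp add: one_pCons)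
  then show ?case using Suc by (simp only: gamma_add gamma_1 of_nat_Suc)
qed (simp add: gamma_0)

sublocale ore_field "CARD('f)" "TYPE('k)"
proof
  have "card {0, 1 :: 'f} \<le> CARD('f)" by (rule card_mono) auto
  then show q: "2 \<le> CARD('f)" by simp
  fix x y :: 'k
  \<comment> \<open>\<open>\<gamma>\<close> carries the vanishing of the intermediate binomial
    coefficients from \<open>'f\<close> to \<open>'k\<close>.\<close>
  have z: "of_nat (CARD('f) choose j) = (0 :: 'k)" if "0 < j" "j < CARD('f)" for j
    using gamma_of_nat[of "CARD('f) choose j"] finite_field_card_choose_eq_0[OF that]
    by (simp add: gamma_0)
  have "(x + y) ^ CARD('f) = (\<Sum>j\<le>CARD('f). of_nat (CARD('f) choose j) * x ^ j * y ^ (CARD('f) - j))"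
    by (rule binomial_ring)
  also have "\<dots> = (\<Sum>j\<in>{0, CARD('f)}. of_nat (CARD('f) choose j) * x ^ j * y ^ (CARD('f) - j))"
    by (rule sum.mono_neutral_right) (auto simp: z)
  also have "\<dots> = x ^ CARD('f) + y ^ CARD('f)"
    by simp
  finally show "(x + y) ^ CARD('f) = x ^ CARD('f) + y ^ CARD('f)" .
qed

text \<open>The vanishing binomial coefficient at \<open>1\<close>. It makes the top term in
  \<open>card_twist_roots\<close> have derivative zero.\<close>

lemma of_nat_card: "of_nat CARD('f) = (0 :: 'k)"
proof -
  have "of_nat CARD('f) = (0 :: 'f)"
    using finite_field_card_choose_eq_0[where ?'f = 'f, of 1] q_ge_2 by simp
  then show ?thesis using gamma_of_nat[of "CARD('f)"] by (simp only: pCons_0_0 gamma_0)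
qed

lemma phi_add: "\<phi> (a + b) = \<phi> a + \<phi> b"
  and phi_mult: "\<phi> (a * b) = ore_mult CARD('f) (\<phi> a) (\<phi> b)"
  and phi_const: "\<phi> [:c:] = [:\<gamma> [:c:]:]"
  using drinfeld by (simp_all add: drinfeld_module_def)

lemma ev_const: "ore_eval CARD('f) [:c:] x = c * x"
  by (simp add: ore_eval_def)

lemma phi_0: "\<phi> 0 = 0"
  using phi_const[of 0] gamma_0 by simp

lemma ev_phi_mult: "ore_eval CARD('f) (\<phi> (a * b)) x = ore_eval CARD('f) (\<phi> a) (ore_eval CARD('f) (\<phi> b) x)"
  by (simp add: phi_mult ore_eval_mult)

lemma ev_phi_commute: "ore_eval CARD('f) (\<phi> a) (ore_eval CARD('f) (\<phi> b) x) = ore_eval CARD('f) (\<phi> b) (ore_eval CARD('f) (\<phi> a) x)"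
  by (metis ev_phi_mult mult.commute)

lemma phi_diff: "\<phi> (a - b) = \<phi> a - \<phi> b"
  using phi_add[of "a - b" b] by (simp add: algebra_simps)

text \<open>Twisted polynomials are determined by their values, so commuting in the ring is
  commuting as maps; the closure properties then reduce to evaluation rules.\<close>

lemma End_iff: "u \<in> drinfeld_End \<phi> \<longleftrightarrow> (\<forall>a x. ore_eval CARD('f) u (ore_eval CARD('f) (\<phi> a) x) = ore_eval CARD('f) (\<phi> a) (ore_eval CARD('f) u x))"
  unfolding drinfeld_End_def mem_Collect_eq ore_eval_mult[symmetric]
  using ore_eval_eqI by metis

lemma End_commute: "u \<in> drinfeld_End \<phi> \<Longrightarrow> ore_eval CARD('f) u (ore_eval CARD('f) (\<phi> a) x) = ore_eval CARD('f) (\<phi> a) (ore_eval CARD('f) u x)"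
  by (simp add: End_iff)

lemma End_0: "0 \<in> drinfeld_End \<phi>"
  by (simp add: End_iff)

lemma End_1: "1 \<in> drinfeld_End \<phi>"
  by (simp add: End_iff one_pCons ev_const)

lemma End_add: "u \<in> drinfeld_End \<phi> \<Longrightarrow> v \<in> drinfeld_End \<phi> \<Longrightarrow> u + v \<in> drinfeld_End \<phi>"
  by (simp add: End_iff ore_eval_add ore_eval_add_right)

lemma End_diff: "u \<in> drinfeld_End \<phi> \<Longrightarrow> v \<in> drinfeld_End \<phi> \<Longrightarrow> u - v \<in> drinfeld_End \<phi>"
  by (simp add: End_iff ore_eval_diff ore_eval_diff_right)

lemma End_mult:
  "u \<in> drinfeld_End \<phi> \<Longrightarrow> v \<in> drinfeld_End \<phi> \<Longrightarrow> ore_mult CARD('f) u v \<in> drinfeld_End \<phi>"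
  by (simp add: End_iff ore_eval_mult)

text \<open>A scalar acts as \<open>\<phi> [:c:]\<close>, and values of \<open>\<phi>\<close>
  commute with each other because \<open>A\<close> is commutative.\<close>

lemma End_smult: "u \<in> drinfeld_End \<phi> \<Longrightarrow> smult (\<gamma> [:c:]) u \<in> drinfeld_End \<phi>"
  using ev_phi_commute[of _ "[:c:]"] by (simp add: End_iff ore_eval_smult phi_const ev_const)

lemma End_le_iff: "u \<in> End_le \<phi> n \<longleftrightarrow> u \<in> drinfeld_End \<phi> \<and> degree u \<le> n"
  unfolding End_le_def using End_0 by auto

lemma End_le_diff: "u \<in> End_le \<phi> n \<Longrightarrow> v \<in> End_le \<phi> n \<Longrightarrow> u - v \<in> End_le \<phi> n"
  by (simp add: End_le_iff End_diff degree_diff_le)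

lemma End_le_mult:
  assumes "u \<in> End_le \<phi> n" "v \<in> End_le \<phi> n'"
  shows "ore_mult CARD('f) u v \<in> End_le \<phi> (n + n')"
proof -
  have "ore_mult CARD('f) u v = 0" if "u = 0 \<or> v = 0"
    by (rule ore_eval_eqI) (use that in \<open>auto simp: ore_eval_mult\<close>)
  then have "degree (ore_mult CARD('f) u v) \<le> n + n'"
    using assms degree_ore_mult(1)[of u v] by (cases "u = 0 \<or> v = 0") (auto simp: End_le_iff)
  then show ?thesis using assms by (simp add: End_le_iff End_mult)
qed

abbreviation scaleF :: "'f \<Rightarrow> 'k poly \<Rightarrow> 'k poly" where
  "scaleF \<equiv> \<lambda>c u. smult (\<gamma> [:c:]) u"

lemma vector_space_scaleF: "vector_space scaleF"
proof
  fix a b :: 'f and x y :: "'k poly"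
  show "scaleF a (x + y) = scaleF a x + scaleF a y" by (rule smult_add_right)
  show "scaleF (a + b) x = scaleF a x + scaleF b x"
    using gamma_add[of "[:a:]" "[:b:]"] by (simp add: smult_add_left)
  show "scaleF a (scaleF b x) = scaleF (a * b) x"
    using gamma_mult[of "[:a:]" "[:b:]"] by (simp add: mult.commute)
  show "scaleF 1 x = x" using gamma_1 by (simp add: one_pCons)
qed

lemma card_End_le:
  assumes "finite (End_le \<phi> n)"
  shows "card (End_le \<phi> n) = CARD('f) ^ dim_Fq \<gamma> (End_le \<phi> n)"
  unfolding dim_Fq_def
proof (rule card_finite_vector_space[OF vector_space_scaleF _ assms])
  interpret vector_space scaleF by (rule vector_space_scaleF)
  show "module.subspace scaleF (End_le \<phi> n)"
    by (rule subspaceI)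
      (auto simp: End_le_iff End_0 End_add End_smult degree_add_le intro: order_trans[OF degree_smult_le])
qed

text \<open>\<open>0\<close> and \<open>1\<close> are already two elements. This keeps the first
  term of \<open>filter_radius\<close> nonnegative.\<close>

lemma dim_End_le_ge_1:
  assumes "finite (End_le \<phi> n)"
  shows "1 \<le> dim_Fq \<gamma> (End_le \<phi> n)"
proof (rule ccontr)
  assume "\<not> ?thesis"
  then have "card (End_le \<phi> n) = 1" using card_End_le[OF assms] by simp
  moreover have "{0, 1} \<subseteq> End_le \<phi> n" by (simp add: End_le_iff End_0 End_1)
  then have "card {0, 1 :: 'k poly} \<le> card (End_le \<phi> n)" by (intro card_mono assms)
  ultimately show False by simp
qed

end

section \<open>Coordinates and matrices on the torsion at one prime\<close>

locale torsion_level = drinfeld \<gamma> \<phi> r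
  for \<gamma> :: "'f::{field,finite} poly \<Rightarrow> 'k::alg_closed_field" and \<phi> r +
  fixes \<qq> :: "'f poly" and \<iota> :: "'f poly \<Rightarrow> 'e::{field,finite}" and b :: "'r::finite \<Rightarrow> 'k"
  assumes iso: "residue_iso \<qq> \<iota>" and basis: "torsion_basis \<phi> \<qq> b"
begin

abbreviation comb :: "('r \<Rightarrow> 'f poly) \<Rightarrow> 'k" where
  "comb \<equiv> torsion_comb \<phi> b"

lemma iota_1: "\<iota> 1 = 1"
  and iota_add: "\<iota> (x + y) = \<iota> x + \<iota> y"
  and iota_mult: "\<iota> (x * y) = \<iota> x * \<iota> y"
  and iota_eq_0: "\<iota> x = 0 \<longleftrightarrow> \<qq> dvd x"
  and surj_iota: "surj \<iota>"
  using iso by (auto simp: residue_iso_def residue_embedding_def)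

lemma iota_diff: "\<iota> (x - y) = \<iota> x - \<iota> y"
  using iota_add[of "x - y" y] by simp

lemma iota_prod: "\<iota> (\<Prod>i\<in>S. f i) = (\<Prod>i\<in>S. \<iota> (f i))"
  by (induction S rule: infinite_finite_induct) (simp_all add: iota_mult iota_1)

lemma b_torsion: "ore_eval CARD('f) (\<phi> \<qq>) (b j) = 0"
  using basis by (auto simp: torsion_basis_def torsion_def)

lemma comb_diff: "comb (\<lambda>j. a j - a' j) = comb a - comb a'"
  by (simp add: torsion_comb_def phi_diff ore_eval_diff sum_subtractf)

lemma comb_add: "comb (\<lambda>j. a j + a' j) = comb a + comb a'"
  by (simp add: torsion_comb_def phi_add ore_eval_add sum.distrib)

lemma comb_mult: "comb (\<lambda>j. c * a j) = ore_eval CARD('f) (\<phi> c) (comb a)"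
  by (simp add: torsion_comb_def ev_phi_mult ore_eval_sum_right)

lemma comb_eq_0_iff: "comb a = 0 \<longleftrightarrow> (\<forall>j. \<qq> dvd a j)"
proof
  assume *: "\<forall>j. \<qq> dvd a j"
  have "ore_eval CARD('f) (\<phi> (a j)) (b j) = 0" for j
  proof -
    from * obtain k where "a j = k * \<qq>" by (auto simp: dvd_def mult.commute)
    then show ?thesis by (simp add: ev_phi_mult b_torsion)
  qed
  then show "comb a = 0" by (simp add: torsion_comb_def)
qed (use basis in \<open>auto simp: torsion_basis_def\<close>)

lemma comb_eq_iff: "comb a = comb a' \<longleftrightarrow> (\<forall>j. \<iota> (a j) = \<iota> (a' j))"
  using comb_eq_0_iff[of "\<lambda>j. a j - a' j"]
  by (simp add: comb_diff iota_diff flip: iota_eq_0)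

text \<open>The coordinate isomorphism onto the torsion. The lifts chosen by
  \<open>inv \<iota>\<close> do not matter, since \<open>comb\<close> depends only on residues
  modulo \<open>\<qq>\<close>.\<close>

definition point :: "'e ^ 'r \<Rightarrow> 'k" where
  "point c = comb (\<lambda>j. inv \<iota> (c $ j))"

lemma iota_inv [simp]: "\<iota> (inv \<iota> x) = x"
  by (rule surj_f_inv_f[OF surj_iota])

lemma comb_eq_point: "comb a = point (\<chi> j. \<iota> (a j))"
  by (simp add: point_def comb_eq_iff)

lemma point_add: "point (c + c') = point c + point c'"
  by (simp add: point_def comb_eq_iff iota_add flip: comb_add)

lemma point_diff: "point (c - c') = point c - point c'"
  using point_add[of "c - c'" c'] by simp

lemma point_eq_0_iff: "point c = 0 \<longleftrightarrow> c = 0"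
  by (simp add: point_def comb_eq_0_iff vec_eq_iff flip: iota_eq_0)

lemma point_0 [simp]: "point 0 = 0"
  by (simp add: point_eq_0_iff)

lemma point_eq_iff: "point c = point c' \<longleftrightarrow> c = c'"
  using point_eq_0_iff[of "c - c'"] by (simp add: point_diff)

lemma ev_phi_point: "ore_eval CARD('f) (\<phi> a) (point c) = point (\<iota> a *s c)"
  by (simp add: point_def comb_eq_iff iota_mult flip: comb_mult)

lemma torsion_eq_range: "torsion \<phi> \<qq> = range point"
proof
  show "torsion \<phi> \<qq> \<subseteq> range point"
    using basis by (auto simp: torsion_basis_def comb_eq_point)
  show "range point \<subseteq> torsion \<phi> \<qq>"
    using iota_eq_0[of \<qq>] by (auto simp: torsion_def ev_phi_point point_eq_0_iff)
qed

lemma coords_point: "torsion_coords \<phi> \<iota> b (point c) = c"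
  unfolding torsion_coords_def
proof (rule the_equality)
  show "\<exists>a. (\<forall>j. \<iota> (a j) = c $ j) \<and> point c = comb a"
    by (rule exI[of _ "\<lambda>j. inv \<iota> (c $ j)"]) (simp add: point_def)
  fix c' assume "\<exists>a. (\<forall>j. \<iota> (a j) = c' $ j) \<and> point c = comb a"
  then show "c' = c" by (auto simp: comb_eq_point point_eq_iff vec_eq_iff)
qed

abbreviation rep :: "'k poly \<Rightarrow> 'e ^ 'r ^ 'r" where
  "rep \<equiv> torsion_rep \<phi> \<iota> b"

lemma ev_b:
  assumes "u \<in> drinfeld_End \<phi>"
  shows "ore_eval CARD('f) u (b j) = point (\<chi> i. rep u $ i $ j)"
proof -
  \<comment> \<open>Commuting with \<open>\<phi> \<qq>\<close> keeps torsion points in the torsion,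
    so the image has coordinates.\<close>
  have "ore_eval CARD('f) u (b j) \<in> torsion \<phi> \<qq>"
    using End_commute[OF assms, of \<qq> "b j"] by (simp add: torsion_def b_torsion)
  then obtain c where "ore_eval CARD('f) u (b j) = point c" by (auto simp: torsion_eq_range)
  then show ?thesis
    by (simp add: torsion_rep_def coords_point point_eq_iff vec_eq_iff)
qed

lemma point_sum: "point (\<Sum>i\<in>S. f i) = (\<Sum>i\<in>S. point (f i))"
  by (induction S rule: infinite_finite_induct) (simp_all add: point_add point_eq_0_iff)

text \<open>Commuting with \<open>\<phi>\<close> makes an endomorphism linear over the residue
  field, so its values at the basis determine it on the torsion.\<close>

lemma ev_point:
  assumes "u \<in> drinfeld_End \<phi>"
  shows "ore_eval CARD('f) u (point c) = point (rep u *v c)"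
proof -
  have "ore_eval CARD('f) u (point c) = (\<Sum>j\<in>UNIV. ore_eval CARD('f) (\<phi> (inv \<iota> (c $ j))) (ore_eval CARD('f) u (b j)))"
    using assms by (simp add: point_def torsion_comb_def ore_eval_sum_right End_commute)
  also have "\<dots> = (\<Sum>j\<in>UNIV. point (c $ j *s (\<chi> i. rep u $ i $ j)))"
    by (simp only: ev_b[OF assms] ev_phi_point iota_inv)
  also have "\<dots> = point (\<Sum>j\<in>UNIV. c $ j *s (\<chi> i. rep u $ i $ j))"
    by (rule point_sum[symmetric])
  also have "(\<Sum>j\<in>UNIV. c $ j *s (\<chi> i. rep u $ i $ j)) = rep u *v c"
    by (simp add: vec_eq_iff matrix_vector_mult_def mult.commute)
  finally show ?thesis .
qed

text \<open>\<open>point\<close> is injective, so a matrix is recovered from its action; sums and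
  products of matrices then follow from evaluation.\<close>

lemma rep_eqI:
  assumes "u \<in> drinfeld_End \<phi>" "\<And>c. ore_eval CARD('f) u (point c) = point (M *v c)"
  shows "rep u = M"
  using assms by (simp add: ev_point point_eq_iff matrix_eq)

lemma rep_0: "rep 0 = 0"
  by (rule rep_eqI) (simp_all add: End_0 point_eq_0_iff)

lemma rep_diff:
  "u \<in> drinfeld_End \<phi> \<Longrightarrow> v \<in> drinfeld_End \<phi> \<Longrightarrow> rep (u - v) = rep u - rep v"
  by (rule rep_eqI)
    (simp_all add: End_diff ore_eval_diff ev_point matrix_vector_mult_diff_rdistrib point_diff)

lemma rep_mult:
  "u \<in> drinfeld_End \<phi> \<Longrightarrow> v \<in> drinfeld_End \<phi> \<Longrightarrow>
     rep (ore_mult CARD('f) u v) = rep u ** rep v"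
  by (rule rep_eqI)
    (simp_all add: End_mult ore_eval_mult ev_point flip: matrix_vector_mul_assoc)

end

section \<open>The code and its decoder\<close>

text \<open>Coprimality of the moduli enters as \<open>not_dvd\<close>: the residue rings are
  fields, so the product of the other moduli stays nonzero modulo each one.\<close>

locale torsion_family = drinfeld \<gamma> \<phi> r
  for \<gamma> :: "'f::{field,finite} poly \<Rightarrow> 'k::alg_closed_field" and \<phi> r +
  fixes \<qq> :: "'l::finite \<Rightarrow> 'f poly" and \<iota> :: "'l \<Rightarrow> 'f poly \<Rightarrow> 'e::{field,finite}"
    and b :: "'l \<Rightarrow> 'r::finite \<Rightarrow> 'k" and m :: nat
  assumes level: "\<And>i. torsion_level \<gamma> \<phi> r (\<qq> i) (\<iota> i) (b i)"
    and not_dvd: "\<And>i j. i \<noteq> j \<Longrightarrow> \<not> \<qq> i dvd \<qq> j"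
    and card_residue: "CARD('e) = CARD('f) ^ m"
    and m_pos: "0 < m"
begin

sublocale L: torsion_level \<gamma> \<phi> r "\<qq> i" "\<iota> i" "b i" for i
  by (rule level)

abbreviation rho :: "'l \<Rightarrow> 'k poly \<Rightarrow> 'e ^ 'r ^ 'r" where
  "rho \<equiv> \<lambda>i. torsion_rep \<phi> (\<iota> i) (b i)"

text \<open>Multiplying by \<open>\<Prod>\<^sub>j\<^sub>\<noteq>\<^sub>i \<qq> j\<close> kills every summand but the \<open>i\<close>-th, on which it is invertible.\<close>
lemma sum_point_eq_0:
  assumes "(\<Sum>i\<in>UNIV. L.point i (c i)) = 0"
  shows "c i = 0"
proof -
  define Q where "Q = (\<Prod>j\<in>UNIV - {i}. \<qq> j)"
  have Q: "\<iota> j Q = 0" if "j \<noteq> i" for j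
    using that unfolding Q_def L.iota_eq_0 by (intro dvd_prodI) auto
  have Qi: "\<iota> i Q \<noteq> 0"
    using not_dvd[of i] by (auto simp: Q_def L.iota_prod L.iota_eq_0)
  have "0 = ore_eval CARD('f) (\<phi> Q) (\<Sum>j\<in>UNIV. L.point j (c j))"
    using assms by simp
  also have "\<dots> = (\<Sum>j\<in>UNIV. L.point j (\<iota> j Q *s c j))"
    by (simp add: ore_eval_sum_right L.ev_phi_point)
  also have "\<dots> = (\<Sum>j\<in>{i}. L.point j (\<iota> j Q *s c j))"
    by (rule sum.mono_neutral_right) (auto simp: Q L.point_eq_0_iff)
  finally show ?thesis
    using Qi by (simp add: L.point_eq_0_iff eq_commute[of 0] vec_eq_iff)
qed

lemma prod_card_kernel_le:
  assumes "w \<in> drinfeld_End \<phi>" "w \<noteq> 0"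
  shows "(\<Prod>i\<in>UNIV. card {c. rho i w *v c = 0}) \<le> CARD('f) ^ degree w"
proof -
  let ?K = "PiE (UNIV :: 'l set) (\<lambda>i. {c. rho i w *v c = 0})"
  let ?f = "\<lambda>c. \<Sum>i\<in>UNIV. L.point i (c i)"
  have "inj_on ?f ?K"
  proof (rule inj_onI)
    fix c c' assume "?f c = ?f c'"
    then have "(\<Sum>i\<in>UNIV. L.point i (c i - c' i)) = 0"
      by (simp add: L.point_diff sum_subtractf)
    then have "c i - c' i = 0" for i by (rule sum_point_eq_0)
    then show "c = c'" by auto
  qed
  moreover have "?f ` ?K \<subseteq> {x. ore_eval CARD('f) w x = 0}"
    by (auto simp: ore_eval_sum_right L.ev_point[OF assms(1)] L.point_eq_0_iff PiE_iff)
  ultimately have "card ?K \<le> card {x. ore_eval CARD('f) w x = 0}"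
    using card_ore_roots(1)[OF assms(2)] by (rule card_inj_on_le)
  then show ?thesis
    using card_ore_roots(2)[OF assms(2)] by (simp add: card_PiE)
qed

text \<open>Serves three times: \<open>M i = rho i w\<close> bounds the minimum distance, the error
  tuple gives uniqueness in decoding, and \<open>M i = 0\<close> gives injectivity of the
  encoding.\<close>

lemma weight_degree_bound:
  fixes M :: "'l \<Rightarrow> 'e ^ 'r ^ 'r"
  assumes w: "w \<in> drinfeld_End \<phi>" "w \<noteq> 0"
    and ker: "\<And>i c. M i *v c = 0 \<Longrightarrow> rho i w *v c = 0"
  shows "m * (CARD('l) * CARD('r)) \<le> degree w + m * wt_SR M"
proof -
  have "CARD('f) ^ (m * (\<Sum>i\<in>UNIV. CARD('r) - rank (M i)))
      = (\<Prod>i\<in>UNIV. CARD('e) ^ (CARD('r) - rank (M i)))"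
    by (simp add: card_residue power_sum sum_distrib_left flip: power_mult)
  also have "\<dots> \<le> (\<Prod>i\<in>UNIV. card {c. rho i w *v c = 0})"
    by (intro prod_mono conjI order_trans[OF card_kernel_ge] card_mono) (auto intro: ker)
  also have "\<dots> \<le> CARD('f) ^ degree w"
    by (rule prod_card_kernel_le[OF w])
  finally have "m * (\<Sum>i\<in>UNIV. CARD('r) - rank (M i)) \<le> degree w"
    using q_ge_2 by (simp add: power_le_imp_le_exp)
  \<comment> \<open>Holds termwise even where \<open>CARD('r) - rank (M i)\<close> truncates to
    0.\<close>
  moreover have "(\<Sum>i\<in>(UNIV :: 'l set). CARD('r)) \<le> (\<Sum>i\<in>UNIV. CARD('r) - rank (M i)) + wt_SR M"
    unfolding wt_SR_def sum.distrib[symmetric] by (rule sum_mono) simp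
  then have "m * (CARD('l) * CARD('r)) \<le> m * (\<Sum>i\<in>UNIV. CARD('r) - rank (M i)) + m * wt_SR M"
    unfolding distrib_left[symmetric] by (intro mult_le_mono2) simp
  ultimately show ?thesis by linarith
qed

text \<open>Below this degree no nonzero endomorphism vanishes on all the torsion modules, and there
  are only finitely many matrix tuples.\<close>

lemma finite_End_le:
  assumes "n < m * (CARD('l) * CARD('r))"
  shows "finite (End_le \<phi> n)"
proof (rule inj_on_finite[of "\<lambda>u i. rho i u" _ UNIV])
  show "inj_on (\<lambda>u i. rho i u) (End_le \<phi> n)"
  proof (rule inj_onI, rule ccontr)
    fix u v assume uv: "u \<in> End_le \<phi> n" "v \<in> End_le \<phi> n" "(\<lambda>i. rho i u) = (\<lambda>i. rho i v)" "u \<noteq> v"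
    have "rho i (u - v) = 0" for i
      using uv fun_cong[OF uv(3), of i] by (simp add: L.rep_diff End_le_iff)
    then have "m * (CARD('l) * CARD('r)) \<le> degree (u - v) + m * wt_SR (\<lambda>_ :: 'l. 0 :: 'e ^ 'r ^ 'r)"
      using uv by (intro weight_degree_bound) (auto simp: End_le_iff End_diff)
    moreover have "degree (u - v) \<le> n"
      using uv by (simp add: End_le_iff degree_diff_le)
    ultimately show False using assms by (simp add: wt_SR_0)
  qed
qed auto

text \<open>Each unit of rank leaves at most \<open>CARD('e)\<close> choices in each of
  \<open>CARD('r)\<close> rows, whence the factor \<open>m * CARD('r)\<close>. Two colliding
  endomorphisms differ by an annihilator.\<close>

lemma exists_annihilator:
  fixes M :: "'l \<Rightarrow> 'e ^ 'r ^ 'r"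
  assumes fin: "finite (End_le \<phi> n)" and dim: "m * CARD('r) * wt_SR M < dim_Fq \<gamma> (End_le \<phi> n)"
  obtains v where "v \<in> End_le \<phi> n" "v \<noteq> 0" "\<And>i. rho i v ** M i = 0"
proof -
  let ?f = "\<lambda>v i. rho i v ** M i"
  let ?R = "PiE (UNIV :: 'l set) (\<lambda>i. range (\<lambda>X :: 'e ^ 'r ^ 'r. X ** M i))"
  have "card (?f ` End_le \<phi> n) \<le> card ?R"
    by (intro card_mono finite_PiE) (auto simp: PiE_iff)
  also have "\<dots> = (\<Prod>i\<in>UNIV. card (range (\<lambda>X :: 'e ^ 'r ^ 'r. X ** M i)))"
    by (rule card_PiE) simp
  also have "\<dots> \<le> (\<Prod>i\<in>UNIV. (CARD('e) ^ rank (M i)) ^ CARD('r))"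
    by (intro prod_mono conjI card_left_multiples_le) simp
  also have "\<dots> = CARD('f) ^ (m * CARD('r) * wt_SR M)"
    by (simp add: card_residue wt_SR_def power_sum sum_distrib_left mult_ac flip: power_mult)
  also have "\<dots> < card (End_le \<phi> n)"
    unfolding card_End_le[OF fin] using dim q_ge_2 by (intro power_strict_increasing) auto
  finally have "\<not> inj_on ?f (End_le \<phi> n)"
    by (rule pigeonhole)
  then obtain u v where uv: "u \<in> End_le \<phi> n" "v \<in> End_le \<phi> n" "?f u = ?f v" "u \<noteq> v"
    by (auto simp: inj_on_def)
  show ?thesis
  proof
    show "u - v \<in> End_le \<phi> n" "u - v \<noteq> 0" using uv by (auto intro: End_le_diff)
    show "rho i (u - v) ** M i = 0" for i
      using uv fun_cong[OF uv(3), of i] by (simp add: L.rep_diff End_le_iff matrix_diff_left)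
  qed
qed

lemma filter_decoder_corrects:
  assumes params: "filter_params \<gamma> \<phi> m CARD('r) CARD('l) s lam \<epsilon>"
  shows "filter_decoder_corrects \<phi> rho s lam \<epsilon>"
  unfolding filter_decoder_corrects_def
proof (intro ballI allI impI)
  fix u and E :: "'l \<Rightarrow> 'e ^ 'r ^ 'r"
  assume u: "u \<in> End_le \<phi> s" and E: "int (wt_SR E) \<le> \<epsilon>"
  define Y where "Y = (\<lambda>i. rho i u + E i)"
  define S where "S = filter_solutions \<phi> rho s lam Y - {(0, 0)}"
  have uE: "u \<in> drinfeld_End \<phi>" using u by (simp add: End_le_iff)
  have "int m * \<epsilon> \<ge> int m * int (wt_SR E)" using E by (intro mult_left_mono) auto
  moreover have "int (lam + s) < int m * int (CARD('l) * CARD('r)) - int m * \<epsilon>"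
    using params by (simp add: filter_params_def right_diff_distrib)
  ultimately have "int (lam + s + m * wt_SR E) < int (m * (CARD('l) * CARD('r)))"
    by simp
  then have deg: "lam + s + m * wt_SR E < m * (CARD('l) * CARD('r))"
    by (simp only: of_nat_less_iff)
  have dim: "m * CARD('r) * wt_SR E < dim_Fq \<gamma> (End_le \<phi> lam)"
  proof -
    have "int (m * CARD('r)) * int (wt_SR E) \<le> int (m * CARD('r)) * \<epsilon>"
      using E by (intro mult_left_mono) auto
    also have "\<dots> < int (dim_Fq \<gamma> (End_le \<phi> lam))"
      using params by (simp add: filter_params_def)
    finally show ?thesis by (simp only: of_nat_mult[symmetric] of_nat_less_iff)
  qed
  have sol: "v \<noteq> 0 \<and> N = ore_mult CARD('f) v u" if "(v, N) \<in> S" for v N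
  proof -
    have v: "v \<in> End_le \<phi> lam" "v \<in> drinfeld_End \<phi>"
      and N: "N \<in> End_le \<phi> (lam + s)" "N \<in> drinfeld_End \<phi>"
      and eq: "rho i v ** Y i = rho i N" and nz: "v \<noteq> 0 \<or> N \<noteq> 0" for i
      using that by (auto simp: S_def filter_solutions_def End_le_iff)
    \<comment> \<open>\<open>w\<close> acts on the torsion as \<open>rho i v ** E i\<close>, so it
      vanishes on the kernels of the \<open>E i\<close>, which are too large for its degree.\<close>
    define w where "w = N - ore_mult CARD('f) v u"
    have w: "w \<in> End_le \<phi> (lam + s)"
      unfolding w_def using N v u by (intro End_le_diff End_le_mult)
    have "rho i w = rho i v ** E i" for i
      using N v uE eq[of i]
      by (simp add: w_def L.rep_diff End_mult L.rep_mult Y_def matrix_add_ldistrib algebra_simps)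
    then have "rho i w *v c = 0" if "E i *v c = 0" for i c
      using that by (simp flip: matrix_vector_mul_assoc)
    then have "w = 0"
      using weight_degree_bound[of w E] w deg by (fastforce simp: End_le_iff)
    \<comment> \<open>If \<open>v = 0\<close>, then \<open>N = 0\<close> as well, and
      \<open>(0, 0)\<close> was removed from \<open>S\<close>.\<close>
    then show ?thesis using nz by (auto simp: w_def ore_mult_def)
  qed
  have fin: "filter_finish \<phi> rho s \<epsilon> Y z = Some u" if "z \<in> S" for z
  proof -
    obtain v N where z: "z = (v, N)" by force
    with sol that have "v \<noteq> 0" "N = ore_mult CARD('f) v u" by auto
    then show ?thesis
      using u E by (simp add: z filter_finish_def ore_left_div_exact Y_def)
  qed
  have "finite (End_le \<phi> lam)" using deg by (intro finite_End_le) simp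
  then obtain v where v: "v \<in> End_le \<phi> lam" "v \<noteq> 0" "\<And>i. rho i v ** E i = 0"
    using exists_annihilator dim by blast
  \<comment> \<open>The annihilator cancels the error, so with \<open>N = v u\<close> it solves the
    filter equations.\<close>
  have "(v, ore_mult CARD('f) v u) \<in> S"
    using v u uE End_le_mult[of v lam u s]
    by (auto simp: S_def filter_solutions_def Y_def matrix_add_ldistrib End_le_iff L.rep_mult)
  with fin show "filter_decoder \<phi> rho s lam \<epsilon> (\<lambda>i. rho i u + E i) = {Some u}"
    unfolding filter_decoder_def Let_def Y_def[symmetric] S_def[symmetric] by force
qed

section \<open>Admissible parameters and minimum distance\<close>

lemma filter_params_radius:
  assumes t: "1 \<le> t" "s = t * m - 1" and lam: "lam + s < m * CARD('l) * CARD('r)"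
  shows "filter_params \<gamma> \<phi> m CARD('r) CARD('l) s lam (filter_radius \<gamma> \<phi> m CARD('r) CARD('l) t lam)"
proof -
  let ?D = "dim_Fq \<gamma> (End_le \<phi> lam)" and ?n = "CARD('l) * CARD('r)"
  let ?\<epsilon> = "filter_radius \<gamma> \<phi> m CARD('r) CARD('l) t lam"
  have "1 \<le> t * m" using t m_pos by simp
  \<comment> \<open>\<open>s + 1 = t * m\<close> turns the strict degree bound into the inequality
    that keeps the second floor nonnegative.\<close>
  then have lam': "real lam + real (t * m) \<le> real m * real ?n"
    unfolding of_nat_add[symmetric] of_nat_mult[symmetric] of_nat_le_iff
    using lam t(2) by (simp add: mult.assoc)
  have fin: "finite (End_le \<phi> lam)" using lam by (intro finite_End_le) (simp add: mult.assoc)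
  have mr: "0 < real (m * CARD('r))" using m_pos by simp
  have "0 \<le> \<lfloor>(real ?D - 1) / real (m * CARD('r))\<rfloor>"
    using dim_End_le_ge_1[OF fin] by simp
  moreover have "0 \<le> \<lfloor>(real m * (real ?n - real t) - real lam) / real m\<rfloor>"
    using lam' m_pos by (simp add: algebra_simps)
  ultimately have "0 \<le> ?\<epsilon>" by (simp only: filter_radius_def min.bounded_iff simp_thms)
  \<comment> \<open>Each term of the minimum yields one parameter condition; here
    \<open>?D - 1\<close> in the numerator provides the strict dimension bound.\<close>
  moreover have "real_of_int ?\<epsilon> \<le> (real ?D - 1) / real (m * CARD('r))"
    unfolding filter_radius_def by linarith
  then have "real_of_int (int (m * CARD('r)) * ?\<epsilon>) \<le> real ?D - 1"
    using mr by (simp add: field_simps)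
  then have "int (m * CARD('r)) * ?\<epsilon> < int ?D" by linarith
  moreover have "real_of_int ?\<epsilon> \<le> (real m * (real ?n - real t) - real lam) / real m"
    unfolding filter_radius_def by linarith
  then have "real m * real_of_int ?\<epsilon> \<le> real m * (real ?n - real t) - real lam"
    using m_pos by (simp add: field_simps)
  then have "real_of_int (int lam + int (t * m)) \<le> real_of_int (int m * (int ?n - ?\<epsilon>))"
    by (simp add: algebra_simps)
  then have "int lam + int (t * m) \<le> int m * (int ?n - ?\<epsilon>)" by (simp only: of_int_le_iff)
  then have "int (lam + s) < int m * (int ?n - ?\<epsilon>)"
    using \<open>1 \<le> t * m\<close> t(2) by linarith
  ultimately show ?thesis by (simp only: filter_params_def simp_thms)
qed

text \<open>The upper bound is the Singleton argument: some nonzero codeword vanishes on \<open>t - 1\<close>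
  prescribed rows.\<close>
lemma min_dist_drinfeld_code:
  assumes t: "1 \<le> t" "t \<le> CARD('l) * CARD('r)" and s: "s = t * m - 1"
    and card: "card (End_le \<phi> s) = CARD('f) ^ (CARD('r) * (s + 1))"
  shows "min_dist_SR (drinfeld_code \<phi> rho s) = CARD('l) * CARD('r) - t + 1"
  unfolding min_dist_SR_def
proof (rule Least_equality)
  let ?n = "CARD('l) * CARD('r)"
  have "1 \<le> t * m" using t m_pos by simp
  have lower: "?n - t + 1 \<le> wt_SR (\<lambda>i. rho i u)" if u: "u \<in> End_le \<phi> s" "u \<noteq> 0" for u
  proof -
    have "m * ?n \<le> degree u + m * wt_SR (\<lambda>i. rho i u)"
      using u by (intro weight_degree_bound) (auto simp: End_le_iff)
    moreover have "degree u < t * m"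
      using u s \<open>1 \<le> t * m\<close> unfolding End_le_iff by linarith
    \<comment> \<open>Strictness before cancelling \<open>m\<close> is what yields the
      \<open>+ 1\<close> in the distance.\<close>
    ultimately have "m * ?n < m * (t + wt_SR (\<lambda>i. rho i u))"
      by (simp add: distrib_left mult.commute)
    then have "?n < t + wt_SR (\<lambda>i. rho i u)" by simp
    then show ?thesis using t(2) by linarith
  qed
  {
    fix y assume "\<exists>X\<in>drinfeld_code \<phi> rho s. X \<noteq> (\<lambda>_. 0) \<and> wt_SR X = y"
    then obtain u where u: "u \<in> End_le \<phi> s" "(\<lambda>i. rho i u) \<noteq> (\<lambda>_. 0)" "wt_SR (\<lambda>i. rho i u) = y"
      by (auto simp: drinfeld_code_def)
    then have "u \<noteq> 0" by (auto simp: L.rep_0)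
    with u lower show "?n - t + 1 \<le> y" by blast
  }
  have "t - 1 \<le> CARD('l \<times> 'r)" using t by simp
  then obtain S :: "('l \<times> 'r) set" where S: "card S = t - 1"
    using obtain_subset_with_card_n by metis
  \<comment> \<open>The rows in \<open>S\<close> take at most
    \<open>CARD('f) ^ (CARD('r) * (m * (t - 1)))\<close> values, fewer than
    \<open>End_le \<phi> s\<close> has elements because \<open>m * (t - 1) < s + 1\<close>.\<close>
  let ?f = "\<lambda>u. restrict (\<lambda>(i, j). rho i u $ j) S"
  have "card (?f ` End_le \<phi> s) \<le> card (S \<rightarrow>\<^sub>E (UNIV :: ('e ^ 'r) set))"
    by (intro card_mono finite_PiE) auto
  also have "\<dots> = CARD('f) ^ (CARD('r) * (m * (t - 1)))"
    by (simp add: card_PiE S card_residue mult_ac flip: power_mult)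
  also have "\<dots> < card (End_le \<phi> s)"
  proof -
    have "m * (t - 1) < m * t" using t m_pos by simp
    then have "CARD('r) * (m * (t - 1)) < CARD('r) * (s + 1)"
      using s \<open>1 \<le> t * m\<close> by (simp add: mult.commute)
    then show ?thesis unfolding card using q_ge_2 by (intro power_strict_increasing) auto
  qed
  finally have "\<not> inj_on ?f (End_le \<phi> s)" by (rule pigeonhole)
  then obtain u v where uv: "u \<in> End_le \<phi> s" "v \<in> End_le \<phi> s" "?f u = ?f v" "u \<noteq> v"
    by (auto simp: inj_on_def)
  define X where "X = (\<lambda>i. rho i (u - v))"
  have w: "u - v \<in> End_le \<phi> s" "u - v \<noteq> 0" using uv by (auto intro: End_le_diff)
  have "X i $ j = 0" if "(i, j) \<in> S" for i j
  proof -
    have "rho i u $ j = rho i v $ j"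
      using fun_cong[OF uv(3), of "(i, j)"] that by simp
    then show ?thesis using uv(1,2) by (simp add: X_def L.rep_diff End_le_iff)
  qed
  then have "wt_SR X \<le> card (UNIV - S)"
    by (intro order_trans[OF wt_SR_le_nonzero_rows] card_mono) auto
  also have "\<dots> = ?n - t + 1"
    using t by (simp add: card_Diff_subset S)
  finally have "wt_SR X = ?n - t + 1"
    using lower[OF w] by (simp add: X_def)
  moreover from this have "X \<noteq> (\<lambda>_. 0)" by (auto simp: wt_SR_0)
  moreover have "X \<in> drinfeld_code \<phi> rho s"
    using w by (auto simp: drinfeld_code_def X_def)
  ultimately show "\<exists>X\<in>drinfeld_code \<phi> rho s. X \<noteq> (\<lambda>_. 0) \<and> wt_SR X = ?n - t + 1"
    by blast
qed

end

section \<open>Characteristic \<open>(T)\<close>\<close>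

context drinfeld
begin

text \<open>\<open>A\<close> is generated by \<open>T\<close> and the constants, and constants pass
  through every twisted polynomial because \<open>c ^ CARD('f) = c\<close>.\<close>

lemma End_iff_commute_T:
  "u \<in> drinfeld_End \<phi> \<longleftrightarrow>
     (\<forall>x. ore_eval CARD('f) u (ore_eval CARD('f) (\<phi> [:0, 1:]) x)
        = ore_eval CARD('f) (\<phi> [:0, 1:]) (ore_eval CARD('f) u x))"
proof
  assume T: "\<forall>x. ore_eval CARD('f) u (ore_eval CARD('f) (\<phi> [:0, 1:]) x)
        = ore_eval CARD('f) (\<phi> [:0, 1:]) (ore_eval CARD('f) u x)"
  have const: "ore_eval CARD('f) u (\<gamma> [:c:] * x) = \<gamma> [:c:] * ore_eval CARD('f) u x" for c x
  proof -
    have "[:c:] ^ (CARD('f) ^ i) = [:c:]" for i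
      by (induction i) (simp_all add: power_mult poly_const_pow finite_field_power_card)
    moreover have "\<gamma> (a ^ n) = \<gamma> a ^ n" for a n
      by (induction n) (simp_all add: gamma_1 gamma_mult)
    ultimately have "\<gamma> [:c:] ^ (CARD('f) ^ i) = \<gamma> [:c:]" for i by metis
    then show ?thesis
      by (simp add: ore_eval_def power_mult_distrib sum_distrib_left mult_ac)
  qed
  have "ore_eval CARD('f) u (ore_eval CARD('f) (\<phi> a) x)
      = ore_eval CARD('f) (\<phi> a) (ore_eval CARD('f) u x)" for a x
  proof (induction a arbitrary: x)
    case (pCons c a)
    have eq: "pCons c a = [:c:] + [:0, 1:] * a" by simp
    show ?case
      unfolding eq phi_add ore_eval_add ev_phi_mult ore_eval_add_right phi_const ev_const const
      using T pCons.IH by simp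
  qed (simp add: phi_0)
  then show "u \<in> drinfeld_End \<phi>" by (simp add: End_iff)
qed (simp add: End_commute)

text \<open>Multiplying by a monomial on either side only shifts degrees, so comparing the two
  products \<open>U\<close> and \<open>V\<close> gives one equation per coefficient.\<close>

lemma End_iff_coeff:
  assumes T: "\<phi> [:0, 1:] = monom g r"
  shows "u \<in> drinfeld_End \<phi> \<longleftrightarrow>
    (\<forall>i. coeff u i * g ^ (CARD('f) ^ i) = g * coeff u i ^ (CARD('f) ^ r))"
proof -
  define U where "U = (\<Sum>i\<le>degree u. monom (coeff u i * g ^ (CARD('f) ^ i)) (i + r))"
  define V where "V = (\<Sum>i\<le>degree u. monom (g * coeff u i ^ (CARD('f) ^ r)) (i + r))"
  have U: "ore_eval CARD('f) U x = ore_eval CARD('f) u (ore_eval CARD('f) (monom g r) x)" for x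
    by (simp add: U_def ore_eval_sum ore_eval_monom ore_eval_def[of _ u] power_mult_distrib
        power_add mult_ac flip: power_mult)
  have V: "ore_eval CARD('f) V x = ore_eval CARD('f) (monom g r) (ore_eval CARD('f) u x)" for x
    by (simp add: V_def ore_eval_sum ore_eval_monom ore_eval_def[of _ u] power_mult_distrib
        frob_pow_sum sum_distrib_left power_add mult_ac flip: power_mult)
  have "u \<in> drinfeld_End \<phi> \<longleftrightarrow> U = V"
    unfolding End_iff_commute_T T U[symmetric] V[symmetric] using ore_eval_eqI by blast
  also have "\<dots> \<longleftrightarrow> (\<forall>i\<le>degree u. coeff u i * g ^ (CARD('f) ^ i) = g * coeff u i ^ (CARD('f) ^ r))"
    (is "_ \<longleftrightarrow> (\<forall>i\<le>_. ?A i)")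
  proof
    assume "U = V"
    then have coeff: "coeff U (i + r) = coeff V (i + r)" for i by simp
    show "\<forall>i\<le>degree u. ?A i"
    proof (intro allI impI)
      fix i assume "i \<le> degree u"
      then show "?A i" using coeff[of i] by (simp add: U_def V_def coeff_sum)
    qed
  qed (simp add: U_def V_def)
  also have "\<dots> \<longleftrightarrow> (\<forall>i. ?A i)"
  proof (intro iffI allI)
    fix i assume "\<forall>i\<le>degree u. ?A i"
    then show "?A i"
      using q_ge_2 by (cases "i \<le> degree u") (simp_all add: coeff_eq_0 zero_power)
  qed simp
  finally show ?thesis .
qed

text \<open>The top term has derivative zero and the linear term a nonzero coefficient, so the
  derivative is a nonzero constant and all roots are simple.\<close>

lemma card_twist_roots:
  fixes g :: 'k
  assumes "g \<noteq> 0" "1 \<le> r"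
  shows "card {x. x * g ^ (CARD('f) ^ i) = g * x ^ (CARD('f) ^ r)} = CARD('f) ^ r"
proof -
  define p where "p = monom g (CARD('f) ^ r) - monom (g ^ (CARD('f) ^ i)) 1"
  have 1: "1 < CARD('f) ^ r" using assms q_ge_2 by (intro one_less_power) auto
  have deg: "degree p = CARD('f) ^ r"
    unfolding p_def diff_conv_add_uminus minus_monom using assms(1) 1
    by (subst degree_add_eq_left) (auto simp: degree_monom_eq intro: le_less_trans[OF degree_monom_le])
  have "pderiv p = [:- (g ^ (CARD('f) ^ i)):]"
    using assms by (simp add: p_def pderiv_diff pderiv_monom of_nat_card zero_power monom_0)
  then have "card {x. poly p x = 0} = CARD('f) ^ r"
    using assms 1 deg by (subst card_roots_separable) auto
  moreover have "{x. poly p x = 0} = {x. x * g ^ (CARD('f) ^ i) = g * x ^ (CARD('f) ^ r)}"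
    by (auto simp: p_def poly_monom mult.commute)
  ultimately show ?thesis by simp
qed

text \<open>The \<open>n + 1\<close> coefficients vary independently, each over
  \<open>CARD('f) ^ r\<close> roots.\<close>

lemma card_End_le_monom:
  assumes T: "\<phi> [:0, 1:] = monom g r" and g: "g \<noteq> 0" "1 \<le> r"
  shows "card (End_le \<phi> n) = CARD('f) ^ (r * (n + 1))"
proof -
  define R where "R = (\<lambda>i. {x. x * g ^ (CARD('f) ^ i) = g * x ^ (CARD('f) ^ r)})"
  have End: "u \<in> End_le \<phi> n \<longleftrightarrow> (\<forall>i. coeff u i \<in> R i) \<and> degree u \<le> n" for u
    by (simp add: End_le_iff End_iff_coeff[OF T] R_def)
  have R0: "0 \<in> R i" for i using q_ge_2 by (simp add: R_def zero_power)
  have "bij_betw (\<lambda>u. restrict (coeff u) {..n}) (End_le \<phi> n) (PiE {..n} R)"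
  proof (rule bij_betw_byWitness[where f' = "\<lambda>c. \<Sum>i\<le>n. monom (c i) i"])
    show "\<forall>u\<in>End_le \<phi> n. (\<Sum>i\<le>n. monom (restrict (coeff u) {..n} i) i) = u"
      by (simp add: End poly_as_sum_of_monoms')
    show "\<forall>c\<in>PiE {..n} R. restrict (coeff (\<Sum>i\<le>n. monom (c i) i)) {..n} = c"
      by (auto simp: coeff_sum PiE_iff extensional_def)
    show "(\<lambda>u. restrict (coeff u) {..n}) ` End_le \<phi> n \<subseteq> PiE {..n} R"
      by (simp add: End image_subset_iff restrict_PiE_iff)
    show "(\<lambda>c. \<Sum>i\<le>n. monom (c i) i) ` PiE {..n} R \<subseteq> End_le \<phi> n"
      using R0 by (auto simp: End coeff_sum PiE_iff intro!: degree_sum_le order_trans[OF degree_monom_le])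
  qed
  then have "card (End_le \<phi> n) = card (PiE {..n} R)" by (rule bij_betw_same_card)
  also have "\<dots> = CARD('f) ^ (r * (n + 1))"
    using card_twist_roots[OF g] by (simp add: card_PiE R_def power_mult del: power_Suc mult_Suc_right)
  finally show ?thesis .
qed

lemma dim_End_le_monom:
  assumes "\<phi> [:0, 1:] = monom g r" and "g \<noteq> 0" "1 \<le> r"
  shows "dim_Fq \<gamma> (End_le \<phi> n) = r * (n + 1)"
proof -
  have card: "card (End_le \<phi> n) = CARD('f) ^ (r * (n + 1))"
    by (rule card_End_le_monom[OF assms])
  then have "finite (End_le \<phi> n)" by (intro card_ge_0_finite) simp
  then show ?thesis
    using card_End_le[of n] q_ge_2 unfolding card by simp
qed

section \<open>The decoding radius in characteristic (T)\<close>

lemma filter_radius_monom: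
  fixes m n t :: nat
  assumes T: "\<phi> [:0, 1:] = monom g r" "g \<noteq> 0" and r: "1 \<le> r" and m: "0 < m" and t: "t \<le> n * r"
  shows "filter_radius \<gamma> \<phi> m r n t (m * ((n * r - t) div 2)) = int ((n * r - t) div 2)"
proof -
  define e where "e = (n * r - t) div 2"
  \<comment> \<open>For \<open>lam = m * e\<close> the dimension is \<open>r * (m * e + 1)\<close>,
    and the quotient exceeds \<open>e\<close> by \<open>(r - 1) / (m * r)\<close>, which lies in [0,
    1).\<close>
  have "\<lfloor>(real (r * (m * e + 1)) - 1) / real (m * r)\<rfloor> = int e"
  proof (rule floor_unique)
    have mr: "0 < real m * real r" using m r by simp
    have "real r \<le> real m * real r"
      using m unfolding of_nat_mult[symmetric] of_nat_le_iff by simp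
    then have "real r < 1 + real m * real r" by simp
    with r show "real_of_int (int e) \<le> (real (r * (m * e + 1)) - 1) / real (m * r)"
      "(real (r * (m * e + 1)) - 1) / real (m * r) < real_of_int (int e) + 1"
      using mr by (simp_all add: field_simps)
  qed
  \<comment> \<open>The second term is \<open>n * r - t - e\<close>, which is at least
    \<open>e\<close>, so the minimum is the first term.\<close>
  moreover have "int e \<le> \<lfloor>(real m * (real (n * r) - real t) - real (m * e)) / real m\<rfloor>"
  proof -
    have "2 * e + t \<le> n * r" using t by (simp add: e_def)
    then have "real (2 * e + t) \<le> real (n * r)" by (simp only: of_nat_le_iff)
    moreover have "(real m * (real (n * r) - real t) - real (m * e)) / real m
        = real (n * r) - real t - real e"
      using m by (simp add: field_simps)
    ultimately show ?thesis by (simp add: le_floor_iff)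
  qed
  ultimately show ?thesis
    by (simp add: filter_radius_def dim_End_le_monom[OF T r] flip: e_def)
qed

end

text \<open>Height \<open>r\<close> at a prime of degree 1 removes every coefficient below
  \<open>r\<close>, and the rank removes those above.\<close>

lemma drinfeld_supersingular_T:
  assumes "drinfeld_module \<gamma> r \<phi>" "supersingular [:0, 1:] r \<phi>"
  shows "\<phi> [:0, 1:] = monom (coeff (\<phi> [:0, 1:]) r) r" "coeff (\<phi> [:0, 1:]) r \<noteq> 0"
proof -
  show "\<phi> [:0, 1:] = monom (coeff (\<phi> [:0, 1:]) r) r"
  proof (rule poly_eqI)
    fix j
    show "coeff (\<phi> [:0, 1:]) j = coeff (monom (coeff (\<phi> [:0, 1:]) r) r) j"
      using assms by (cases j r rule: linorder_cases)
        (auto simp: drinfeld_module_def supersingular_def has_height_def coeff_eq_0)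
  qed
  show "coeff (\<phi> [:0, 1:]) r \<noteq> 0"
    using assms by (simp add: supersingular_def has_height_def)
qed

section \<open>Decoding up to \<open>filter_radius\<close>, and up to the unique-decoding radius in
  characteristic (T)\<close>

theorem corollary4p3:
  fixes \<pp> :: "'f::{field,finite} poly"
    and \<gamma> :: "'f poly \<Rightarrow> 'k::alg_closed_field"
    and \<phi> :: "'f poly \<Rightarrow> 'k poly"
    and \<qq> :: "'l::finite \<Rightarrow> 'f poly"
    and \<iota> :: "'l \<Rightarrow> 'f poly \<Rightarrow> 'e::{field,finite}"
    and b :: "'l \<Rightarrow> 'r::finite \<Rightarrow> 'k"
    and \<rho> :: "'l \<Rightarrow> 'k poly \<Rightarrow> 'e ^ 'r ^ 'r"
    and d r l m t s :: nat
  assumes p: "prime_elem \<pp>" "lead_coeff \<pp> = 1" "d = degree \<pp>"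
    and k: "residue_alg_closure \<pp> \<gamma>"
    and r: "r = CARD('r)" "r \<ge> 2"
    and phi: "drinfeld_module \<gamma> r \<phi>" "supersingular \<pp> r \<phi>"
    and l: "l = CARD('l)"
    and q: "inj \<qq>" "\<And>i. irreducible (\<qq> i)" "\<And>i. lead_coeff (\<qq> i) = 1"
      "\<And>i. degree (\<qq> i) = m" "\<And>i. \<qq> i \<noteq> \<pp>"
    and e: "CARD('e) = CARD('f) ^ m" "\<And>i. residue_iso (\<qq> i) (\<iota> i)"
    and b: "\<And>i. torsion_basis \<phi> (\<qq> i) (b i)"
    and rho: "\<And>i. \<rho> i = torsion_rep \<phi> (\<iota> i) (b i)"
    and t: "1 \<le> t" "t \<le> l * r"
    and s: "s = t * m - 1"
    and bound: "real (t * m - 1) \<ge> real (r ^ 2 * (r - 1) * (d - 1)) / 2"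
  shows "(\<forall>lam. lam + s < m * l * r \<longrightarrow>
            filter_params \<gamma> \<phi> m r l s lam (filter_radius \<gamma> \<phi> m r l t lam) \<and>
            filter_decoder_corrects \<phi> \<rho> s lam (filter_radius \<gamma> \<phi> m r l t lam)) \<and>
         (\<pp> = [:0, 1:] \<longrightarrow>
            (let lam = m * ((l * r - t) div 2);
                 unique_radius = (min_dist_SR (drinfeld_code \<phi> \<rho> s) - 1) div 2
             in lam + s < m * l * r \<and>
                filter_radius \<gamma> \<phi> m r l t lam = int ((l * r - t) div 2) \<and>
                (l * r - t) div 2 = unique_radius \<and>
                filter_decoder_corrects \<phi> \<rho> s lam (int unique_radius)))"
proof -
  have g: "\<gamma> 1 = 1" "\<And>a b. \<gamma> (a + b) = \<gamma> a + \<gamma> b" "\<And>a b. \<gamma> (a * b) = \<gamma> a * \<gamma> b"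
    using k by (auto simp: residue_alg_closure_def residue_embedding_def)
  interpret drinfeld \<gamma> \<phi> r
    using g phi(1) by unfold_locales
  \<comment> \<open>Irreducible polynomials are not units, so their common degree is positive;
    \<open>undefined\<close> supplies an index.\<close>
  have "0 < m"
  proof (rule ccontr)
    assume "\<not> 0 < m"
    then have "degree (\<qq> undefined) = 0" "\<qq> undefined \<noteq> 0"
      using q(4)[of undefined] q(2)[of undefined] by (simp_all add: irreducible_def)
    then have "\<qq> undefined dvd 1" by (simp add: is_unit_iff_degree)
    then show False using q(2) by (auto simp: irreducible_def)
  qed
  interpret torsion_family \<gamma> \<phi> r \<qq> \<iota> b m
  proof
    show "residue_iso (\<qq> i) (\<iota> i)" "torsion_basis \<phi> (\<qq> i) (b i)" for i
      by (fact e(2) b)+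
    show "\<not> \<qq> i dvd \<qq> j" if "i \<noteq> j" for i j
      using monic_dvd_same_degree[of "\<qq> i" "\<qq> j"] q(3,4) that inj_eq[OF q(1)] by auto
  qed (fact e(1) \<open>0 < m\<close>)+
  have \<rho>: "\<rho> = rho" using rho by blast
  have params: "filter_params \<gamma> \<phi> m r l s lam (filter_radius \<gamma> \<phi> m r l t lam)"
    and corrects: "filter_decoder_corrects \<phi> \<rho> s lam (filter_radius \<gamma> \<phi> m r l t lam)"
    if "lam + s < m * l * r" for lam
    using filter_params_radius[OF t(1) s] filter_decoder_corrects that
    unfolding r(1) l \<rho> by blast+
  have "let lam = m * ((l * r - t) div 2);
            unique_radius = (min_dist_SR (drinfeld_code \<phi> \<rho> s) - 1) div 2
        in lam + s < m * l * r \<and>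
           filter_radius \<gamma> \<phi> m r l t lam = int ((l * r - t) div 2) \<and>
           (l * r - t) div 2 = unique_radius \<and>
           filter_decoder_corrects \<phi> \<rho> s lam (int unique_radius)"
    if "\<pp> = [:0, 1:]"
  proof -
    note T = drinfeld_supersingular_T[OF phi(1) phi(2)[unfolded that]]
    have r1: "1 \<le> r" using r(2) by simp
    define e where "e = (l * r - t) div 2"
    \<comment> \<open>From \<open>e + t \<le> l * r\<close> the strict bound on
      \<open>lam + s\<close> follows, since \<open>s\<close> lies one below
      \<open>t * m\<close>.\<close>
    have "e + t \<le> l * r" using t(2) by (simp add: e_def)
    then have "m * (e + t) \<le> m * (l * r)" by (rule mult_le_mono2)
    moreover have "1 \<le> t * m" using t(1) \<open>0 < m\<close> by simp
    ultimately have lam: "m * e + s < m * l * r"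
      unfolding s distrib_left mult.commute[of t] mult.assoc by linarith
    have radius: "filter_radius \<gamma> \<phi> m r l t (m * e) = int e"
      unfolding e_def by (rule filter_radius_monom[OF T r1 \<open>0 < m\<close> t(2)])
    have "min_dist_SR (drinfeld_code \<phi> \<rho> s) = l * r - t + 1"
      using min_dist_drinfeld_code[OF t(1) _ s] card_End_le_monom[OF T r1] t(2)
      unfolding r(1) l \<rho> by blast
    then have "(min_dist_SR (drinfeld_code \<phi> \<rho> s) - 1) div 2 = e"
      by (simp add: e_def)
    then show ?thesis
      using lam radius corrects[OF lam] by (simp add: Let_def flip: e_def)
  qed
  with params corrects show ?thesis by blast
qed

end
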